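(* Let $H=\mathrm{diag}(\lambda_1,\dots,\lambda_d)$ be an invertible $d\times d$ real diagonal matrix with at least one negative eigenvalue, with $\lambda_1\ge\lambda_2\ge\dots\ge\lambda_s>0>\lambda_{s+1}\ge\dots\ge\lambda_d$ and $\lambda_d<0$. Let $\eta(k,\mathbf{x})\in\mathbb{R}^d$ ($k\in\mathbb{N}$, $\mathbf{x}\in\mathbb{R}^d$) be continuously differentiable (in $\mathbf{x}$), with $\eta(k,\mathbf{0})=\mathbf{0}$ for all $k$, and such that for each $\epsilon>0$ there exists a neighborhood of $\mathbf{0}$ in which $$\|\eta(k,\mathbf{x})-\eta(k,\mathbf{y})\|\le\alpha_k\,\epsilon\,\|\mathbf{x}-\mathbf{y}\|\quad\text{for all } k\in\mathbb{N},$$ where $\{\alpha_k\}_{k\in\mathbb{N}}$ is a sequence of positive real numbers of order $\Omega(1/k)$ that converges to zero. Consider the time non-homogeneous dynamical system $$\mathbf{x}_{k+1}=g(k,\mathbf{x}_k),\qquad g(k,\mathbf{x})=(I-\alpha_kH)\mathbf{x}+\eta(k,\mathbf{x}).$$ Write $\mathbb{R}^d=E^s\oplus E^u$, where $E^s$ is the span of the eigenvectors corresponding to positive eigenvalues of $H$ and $E^u$ is the span of the eigenvectors corresponding to negative eigenvalues of $H$. Then there exist a neighborhood $U$ of $\mathbf{0}$ and a $C^1$-manifold $V(\mathbf{0})$ in $U$ that is tangent to $E^s$ at $\mathbf{0}$, such that for all $\mathbf{x}_0\in V(\mathbf{0})$, $\lim_{k\to\infty}g(k,\mathbf{x}_k)=\mathbf{0}$,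 where $\{\mathbf{x}_k\}$ is the trajectory starting at $\mathbf{x}_0$. Moreover, $\bigcap_{k=0}^{\infty}\tilde{g}^{-1}(k,0,U)\subset V(\mathbf{0})$.
   Context: $\mathbb{N}$ denotes the nonnegative integers and $\|\cdot\|$ the Euclidean norm. A positive sequence $\alpha_k$ is of order $\Omega(1/k)$ if there are $c>0$ and $k_0$ with $\alpha_k\ge c/k$ for all $k\ge k_0$. For $m\ge n$, $\tilde{g}(m,n,\mathbf{x})=g(m,\dots,g(n+1,g(n,\mathbf{x}))\dots)$ denotes the composition of the update maps from time $n$ to time $m$, and $\tilde{g}^{-1}(m,n,U)=\{\mathbf{x}:\tilde{g}(m,n,\mathbf{x})\in U\}$.
   Formalization: The last inclusion is proved for initial points in U, i.e. U ∩ ⋂_k g̃^{-1}(k,0,U) ⊂ V(0); without intersecting with U it is false, since g(0,·) may collapse a far-away ball to 0. *)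

theory Defs
  imports "HOL-Analysis.Analysis" "HOL-Library.Landau_Symbols"
begin

section \<open>Diagonal matrices and spectral subspaces\<close>

definition diag_matrix :: "('n \<Rightarrow> real) \<Rightarrow> real^'n^'n"
  where "diag_matrix l = (\<chi> i j. if i = j then l i else 0)"

definition eigenvector :: "real^'n^'n \<Rightarrow> real^'n \<Rightarrow> real \<Rightarrow> bool"
  where "eigenvector A v \<mu> \<longleftrightarrow> v \<noteq> 0 \<and> A *v v = \<mu> *\<^sub>R v"

definition eigenvalue :: "real^'n^'n \<Rightarrow> real \<Rightarrow> bool"
  where "eigenvalue A \<mu> \<longleftrightarrow> (\<exists>v. eigenvector A v \<mu>)"

text \<open>\<open>E\<^sup>s\<close> belongs to the \<^emph>\<open>positive\<close> eigenvalues of \<open>H\<close>: the linear part of the system is \<open>I - \<alpha>\<^sub>k H\<close>.\<close>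

definition stable_space :: "real^'n^'n \<Rightarrow> (real^'n) set"
  where "stable_space A = span {v. \<exists>\<mu>>0. eigenvector A v \<mu>}"

definition unstable_space :: "real^'n^'n \<Rightarrow> (real^'n) set"
  where "unstable_space A = span {v. \<exists>\<mu><0. eigenvector A v \<mu>}"

lemma diag_matrix_mult_vec: "diag_matrix l *v v = (\<chi> i. l i * v $ i)"
  by (simp add: diag_matrix_def matrix_vector_mult_def vec_eq_iff if_distrib if_distribR
      sum.delta cong: if_cong)

lemma diag_matrix_invertible_nonzero:
  assumes "invertible (diag_matrix l :: real^'n^'n)"
  shows "l i \<noteq> 0"
proof
  assume "l i = 0"
  then have "(diag_matrix l :: real^'n^'n) *v axis i 1 = diag_matrix l *v 0"
    by (auto simp: diag_matrix_mult_vec vec_eq_iff axis_def)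
  moreover have "inj ((*v) (diag_matrix l :: real^'n^'n))"
    using assms by (metis invertible_left_inverse matrix_left_invertible_injective)
  ultimately have "axis i (1::real) = (0 :: real^'n)"
    by (meson injD)
  then show False by (simp add: axis_eq_0_iff)
qed

text \<open>The decomposition of the space as the direct sum of \<open>E\<^sup>s\<close> and \<open>E\<^sup>u\<close>.\<close>

lemma stable_unstable_direct_sum:
  assumes "invertible (diag_matrix l :: real^'n^'n)"
  defines "Es \<equiv> stable_space (diag_matrix l :: real^'n^'n)"
    and "Eu \<equiv> unstable_space (diag_matrix l :: real^'n^'n)"
  shows "Es \<inter> Eu = {0}" and "{x + y | x y. x \<in> Es \<and> y \<in> Eu} = UNIV"
proof -
  have Es: "v $ i = 0" if "v \<in> Es" "l i < 0" for v i
    using that(1) unfolding Es_def stable_space_def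
  proof (induction rule: span_induct_alt)
    case (step c x y)
    then obtain \<mu> where "\<mu> > 0" "\<And>i. l i * x $ i = \<mu> * x $ i"
      by (auto simp: eigenvector_def diag_matrix_mult_vec vec_eq_iff)
    with that(2) have "x $ i = 0" by (metis mult_cancel_right less_asym)
    with step show ?case by simp
  qed auto
  have Eu: "v $ i = 0" if "v \<in> Eu" "l i > 0" for v i
    using that(1) unfolding Eu_def unstable_space_def
  proof (induction rule: span_induct_alt)
    case (step c x y)
    then obtain \<mu> where "\<mu> < 0" "\<And>i. l i * x $ i = \<mu> * x $ i"
      by (auto simp: eigenvector_def diag_matrix_mult_vec vec_eq_iff)
    with that(2) have "x $ i = 0" by (metis mult_cancel_right less_asym)
    with step show ?case by simp
  qed auto
  have l: "l i > 0 \<or> l i < 0" for i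
    using diag_matrix_invertible_nonzero[OF assms(1), of i] by linarith
  have "v = 0" if "v \<in> Es" "v \<in> Eu" for v
    unfolding vec_eq_iff using Es[OF that(1)] Eu[OF that(2)] l by (metis zero_index)
  then show "Es \<inter> Eu = {0}"
    by (auto simp: Es_def Eu_def stable_space_def unstable_space_def span_zero)
  have ev: "eigenvector (diag_matrix l) (axis i 1 :: real^'n) (l i)" for i
    by (auto simp: eigenvector_def diag_matrix_mult_vec vec_eq_iff axis_def)
  have in_Es: "axis i 1 \<in> Es" if "l i > 0" for i
    unfolding Es_def stable_space_def using that ev[of i] by (intro span_base) auto
  have in_Eu: "axis i 1 \<in> Eu" if "l i < 0" for i
    unfolding Eu_def unstable_space_def using that ev[of i] by (intro span_base) auto
  have "\<exists>x y. v = x + y \<and> x \<in> Es \<and> y \<in> Eu" for v :: "real^'n"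
  proof (intro exI conjI)
    let ?x = "\<Sum>i\<in>{i. l i > 0}. v $ i *\<^sub>R axis i 1" and ?y = "\<Sum>i\<in>{i. l i < 0}. v $ i *\<^sub>R axis i 1"
    have "v = (\<Sum>i\<in>UNIV. v $ i *\<^sub>R axis i 1)"
      using basis_expansion[of v] by (simp add: scalar_mult_eq_scaleR)
    also have "UNIV = {i. l i > 0} \<union> {i. l i < 0}" using l by auto
    also have "(\<Sum>i\<in>\<dots>. v $ i *\<^sub>R axis i 1) = ?x + ?y"
      by (rule sum.union_disjoint) auto
    finally show "v = ?x + ?y" .
    show "?x \<in> Es" using in_Es unfolding Es_def stable_space_def
      by (intro span_sum span_scale) auto
    show "?y \<in> Eu" using in_Eu unfolding Eu_def unstable_space_def
      by (intro span_sum span_scale) auto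
  qed
  then show "{x + y | x y. x \<in> Es \<and> y \<in> Eu} = UNIV" by blast
qed

section \<open>Embedded \<open>C\<^sup>1\<close> submanifolds\<close>

text \<open>Meant for open \<open>S\<close>. The library's \<open>C1_differentiable_on\<close> covers only functions of a real variable.\<close>

definition C1_on :: "('a::real_normed_vector \<Rightarrow> 'b::real_normed_vector) \<Rightarrow> 'a set \<Rightarrow> bool"
  where "C1_on f S \<longleftrightarrow>
    (\<exists>f' :: 'a \<Rightarrow> 'a \<Rightarrow>\<^sub>L 'b. (\<forall>x\<in>S. (f has_derivative blinfun_apply (f' x)) (at x)) \<and> continuous_on S f')"

text \<open>Submanifold of dimension \<open>m\<close>, without boundary and not necessarily closed:
  near each of its points it is straightened to a linear subspace by a \<open>C\<^sup>1\<close> diffeomorphism of the ambient space.\<close>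

definition C1_submanifold :: "nat \<Rightarrow> 'a::euclidean_space set \<Rightarrow> bool"
  where "C1_submanifold m M \<longleftrightarrow>
    (\<forall>p\<in>M. \<exists>(W::'a set) (W'::'a set) \<Phi> \<Psi> (L::'a set).
       open W \<and> p \<in> W \<and> open W' \<and> homeomorphism W W' \<Phi> \<Psi> \<and> C1_on \<Phi> W \<and> C1_on \<Psi> W' \<and>
       subspace L \<and> dim L = m \<and> \<Phi> ` (W \<inter> M) = W' \<inter> L)"

text \<open>Tangent vectors as velocities of \<open>C\<^sup>1\<close> curves lying in the set.\<close>

definition tangent_space :: "'a::euclidean_space set \<Rightarrow> 'a \<Rightarrow> 'a set"
  where "tangent_space M p =
    {v. \<exists>(\<gamma>::real \<Rightarrow> 'a) e. e > 0 \<and> \<gamma> C1_differentiable_on {-e<..<e} \<and> \<gamma> ` {-e<..<e} \<subseteq> M \<and>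
          \<gamma> 0 = p \<and> (\<gamma> has_vector_derivative v) (at 0)}"

section \<open>Time non-homogeneous iteration\<close>

text \<open>\<open>iterate_maps g m n x = g m (\<dots> (g (n + 1) (g n x)))\<close> for \<open>m \<ge> n\<close>. Both end points are
  included, so a trajectory satisfies \<open>x\<^sub>k\<^sub>+\<^sub>1 = iterate_maps g k 0 x\<^sub>0\<close>; hence
  \<open>\<Inter>k. iterate_maps g k 0 -` U\<close> constrains \<open>x\<^sub>1, x\<^sub>2, \<dots>\<close> but not \<open>x\<^sub>0\<close>.
  The set of initial points whose whole trajectory stays in \<open>U\<close> is therefore
  \<open>U \<inter> (\<Inter>k. iterate_maps g k 0 -` U)\<close>. Without the factor \<open>U\<close>, points far from the origin could
  enter, since \<open>g 0\<close> is unrestricted there and may even collapse an open set to \<open>0\<close>.\<close>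

definition iterate_maps :: "(nat \<Rightarrow> 'a \<Rightarrow> 'a) \<Rightarrow> nat \<Rightarrow> nat \<Rightarrow> 'a \<Rightarrow> 'a"
  where "iterate_maps g m n x = fold g [n..<Suc m] x"

lemma iterate_maps_same: "iterate_maps g n n x = g n x"
  by (simp add: iterate_maps_def)

lemma iterate_maps_Suc: "n \<le> m \<Longrightarrow> iterate_maps g (Suc m) n x = g (Suc m) (iterate_maps g m n x)"
  by (simp add: iterate_maps_def)

end

theory Submission
  imports Defs
begin

text \<open>
  Let \<open>P\<close> and \<open>Q\<close> project onto the stable and the unstable coordinates. A difference \<open>d\<close> of two orbits
  close to the origin that once leaves the cone \<open>norm (Q d) \<le> norm (P d)\<close> never returns to it, and
  its unstable part grows like \<open>\<Prod>k. 1 + b k / 2\<close>, which diverges because \<open>\<alpha>\<close> is not summable; while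
  it stays in the cone, its stable part shrinks like \<open>\<Prod>k. 1 - b k / 2\<close>, hence to \<open>0\<close>. So the points
  whose orbit stays small are those whose orbit stays in the cone, and they form a graph over the
  stable coordinates: two of them differ by a vector in the cone, and a point over each stable
  coordinate is obtained by pulling graphs back \<open>n\<close> times (a contraction at each step) and passing
  to the limit by compactness.

  The graph is \<open>C\<^sup>1\<close> for the same reason: the limits of its difference quotients have bounded orbits
  under the linearised system, and the cone makes such a vector unique over each stable vector; by
  compactness the difference quotients converge, and their limit depends continuously on the point.

  Only the finitely many early steps, where \<open>\<alpha> k * l i\<close> may exceed \<open>1\<close> and the stable coordinates need
  not contract, violate these estimates. Shrinking the stable coordinates by a large factor at each
  of those steps, a conjugation that is the identity at time \<open>0\<close>, restores them.
\<close>

section \<open>Coordinate projections, derivatives and series\<close>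

definition coord_proj :: "'n set \<Rightarrow> real^'n \<Rightarrow> real^'n"
  where "coord_proj S x = (\<chi> i. if i \<in> S then x $ i else 0)"

lemma linear_coord_proj: "linear (coord_proj S)"
  by (rule linearI) (auto simp: coord_proj_def vec_eq_iff)

lemma bounded_linear_coord_proj: "bounded_linear (coord_proj S :: real^'n \<Rightarrow> real^'n)"
  by (simp add: linear_coord_proj linear_conv_bounded_linear[symmetric])

lemmas coord_proj_linear_simps =
  linear_add[OF linear_coord_proj] linear_diff[OF linear_coord_proj]
  linear_0[OF linear_coord_proj] linear_scale[OF linear_coord_proj]

lemma coord_proj_idem [simp]:
  "coord_proj S (coord_proj S x) = coord_proj S x"
  "coord_proj (- S) (coord_proj S x) = 0"
  "coord_proj S (coord_proj (- S) x) = 0"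
  by (auto simp: coord_proj_def vec_eq_iff)

lemma coord_proj_add_compl: "coord_proj S x + coord_proj (- S) x = x"
  by (auto simp: coord_proj_def vec_eq_iff)

lemma norm_coord_proj_le: "norm (coord_proj S x) \<le> norm x"
  by (rule norm_le_componentwise_cart) (auto simp: coord_proj_def)

lemma norm_le_coord_proj: "norm x \<le> norm (coord_proj S x) + norm (coord_proj (- S) x)"
  using norm_triangle_ineq[of "coord_proj S x" "coord_proj (- S) x"]
  by (simp add: coord_proj_add_compl)

lemma tendsto_coord_proj: "(f \<longlongrightarrow> l) F \<Longrightarrow> ((\<lambda>x. coord_proj S (f x)) \<longlongrightarrow> coord_proj S l) F"
  by (rule bounded_linear.tendsto[OF bounded_linear_coord_proj])

lemma continuous_on_coord_proj: "continuous_on A (coord_proj S)"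
  by (simp add: bounded_linear_coord_proj linear_continuous_on)

section \<open>Derivatives as limits of difference quotients\<close>

text \<open>The points \<open>s n\<close> need not lie on a ray, so secants of a set can be pushed
  forward by a differentiable map. Since the quotients are bounded, the remainder vanishes even
  after division by \<open>t n\<close>.\<close>

lemma has_derivative_sequentially:
  assumes f: "(f has_derivative f') (at z)"
    and t: "t \<longlonglongrightarrow> 0" "\<And>n. t n > 0"
    and w: "(\<lambda>n. (1 / t n) *\<^sub>R (s n - z)) \<longlonglongrightarrow> w"
  shows "(\<lambda>n. (1 / t n) *\<^sub>R (f (s n) - f z)) \<longlonglongrightarrow> f' w"
proof -
  interpret f': bounded_linear f' using f by (rule has_derivative_bounded_linear)
  let ?w = "\<lambda>n. (1 / t n) *\<^sub>R (s n - z)"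
  have sz: "s n - z = t n *\<^sub>R ?w n" for n using t(2)[of n] by simp
  have "(\<lambda>n. t n *\<^sub>R ?w n) \<longlonglongrightarrow> 0 *\<^sub>R w" by (intro tendsto_scaleR t w)
  then have s0: "(\<lambda>n. s n - z) \<longlonglongrightarrow> 0" by (simp only: sz[symmetric]) simp
  obtain B where B: "B > 0" "\<And>n. norm (?w n) \<le> B"
    using convergent_imp_Bseq[OF convergentI[OF w]] unfolding Bseq_def by auto
  have "(\<lambda>n. (1 / t n) *\<^sub>R (f (s n) - f z - f' (s n - z))) \<longlonglongrightarrow> 0"
  proof (rule LIMSEQ_I)
    fix r :: real assume r: "0 < r"
    then have "r / (2 * B) > 0" using B by simp
    then obtain d where d: "d > 0"
      "\<And>y. norm (y - z) < d \<Longrightarrow> norm (f y - f z - f' (y - z)) \<le> r / (2 * B) * norm (y - z)"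
      using f unfolding has_derivative_at_alt by blast
    obtain N where N: "\<And>n. n \<ge> N \<Longrightarrow> norm (s n - z) < d"
      using LIMSEQ_D[OF s0 d(1)] by auto
    have "norm ((1 / t n) *\<^sub>R (f (s n) - f z - f' (s n - z)) - 0) < r" if "n \<ge> N" for n
    proof -
      have "norm ((1 / t n) *\<^sub>R (f (s n) - f z - f' (s n - z)))
          \<le> (1 / t n) * (r / (2 * B) * norm (s n - z))"
        using mult_left_mono[OF d(2)[OF N[OF that]], of "1 / t n"] t(2)[of n] by simp
      also have "\<dots> = r / (2 * B) * norm (?w n)"
        unfolding norm_scaleR using t(2)[of n] by simp
      also have "\<dots> \<le> r / (2 * B) * B"
        using B r by (intro mult_left_mono) auto
      also have "\<dots> < r" using B r by simp
      finally show ?thesis by simp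
    qed
    then show "\<exists>no. \<forall>n\<ge>no. norm ((1 / t n) *\<^sub>R (f (s n) - f z - f' (s n - z)) - 0) < r" by blast
  qed
  from tendsto_add[OF this f'.tendsto[OF w]] show ?thesis
    by (simp add: f'.scaleR f'.diff algebra_simps)
qed

text \<open>Along the ray from \<open>z\<close> in direction \<open>w\<close> the quotients are
  eventually bounded by \<open>C * norm w\<close>, and the bound survives the limit.\<close>

lemma has_derivative_norm_bound:
  fixes f :: "'a::real_normed_vector \<Rightarrow> 'b::real_normed_vector"
  assumes f: "(f has_derivative f') (at z)" and S: "open S" "z \<in> S"
    and lip: "\<And>x. x \<in> S \<Longrightarrow> norm (f x - f z) \<le> C * norm (x - z)"
  shows "norm (f' w) \<le> C * norm w"
proof -
  let ?t = "\<lambda>n. inverse (real (Suc n))" and ?s = "\<lambda>n. z + inverse (real (Suc n)) *\<^sub>R w"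
  have s: "?s \<longlonglongrightarrow> z"
    using tendsto_add[OF tendsto_const tendsto_scaleR[OF LIMSEQ_inverse_real_of_nat tendsto_const], of z w]
    by simp
  have "(\<lambda>n. (1 / ?t n) *\<^sub>R (f (?s n) - f z)) \<longlonglongrightarrow> f' w"
    by (rule has_derivative_sequentially[OF f LIMSEQ_inverse_real_of_nat]) auto
  then have "(\<lambda>n. norm ((1 / ?t n) *\<^sub>R (f (?s n) - f z))) \<longlonglongrightarrow> norm (f' w)"
    by (rule tendsto_norm)
  moreover have "\<forall>\<^sub>F n in sequentially. norm ((1 / ?t n) *\<^sub>R (f (?s n) - f z)) \<le> C * norm w"
    using topological_tendstoD[OF s S]
  proof eventually_elim
    case (elim n)
    have "norm ((1 / ?t n) *\<^sub>R (f (?s n) - f z)) \<le> (1 / ?t n) * (C * norm (?s n - z))"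
      using mult_left_mono[OF lip[OF elim], of "1 / ?t n"] by simp
    then show ?case by simp
  qed
  ultimately show ?thesis by (rule tendsto_upperbound) simp
qed

section \<open>Calculus of continuously differentiable maps\<close>

lemma C1_on_imp_continuous_on: "C1_on f S \<Longrightarrow> continuous_on S f"
  unfolding C1_on_def
  by (meson continuous_at_imp_continuous_on has_derivative_continuous)

lemma C1_on_linear: "bounded_linear h \<Longrightarrow> C1_on h S"
  unfolding C1_on_def
  by (rule exI[of _ "\<lambda>_. Blinfun h"])
    (simp add: bounded_linear_Blinfun_apply bounded_linear_imp_has_derivative)

lemma C1_on_add:
  assumes "C1_on f S" "C1_on h S"
  shows "C1_on (\<lambda>x. f x + h x) S"
proof -
  obtain f' h' where "\<And>x. x \<in> S \<Longrightarrow> (f has_derivative blinfun_apply (f' x)) (at x)"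
    "continuous_on S f'" "\<And>x. x \<in> S \<Longrightarrow> (h has_derivative blinfun_apply (h' x)) (at x)"
    "continuous_on S h'" using assms unfolding C1_on_def by blast
  then show ?thesis unfolding C1_on_def
    by (intro exI[of _ "\<lambda>x. f' x + h' x"])
      (auto simp: plus_blinfun.rep_eq intro!: has_derivative_add continuous_on_add)
qed

lemma C1_on_compose:
  assumes f: "C1_on f S" and h: "C1_on h T" and sub: "f ` S \<subseteq> T"
  shows "C1_on (\<lambda>x. h (f x)) S"
proof -
  obtain f' where f': "\<And>x. x \<in> S \<Longrightarrow> (f has_derivative blinfun_apply (f' x)) (at x)"
    "continuous_on S f'" using f unfolding C1_on_def by blast
  obtain h' where h': "\<And>x. x \<in> T \<Longrightarrow> (h has_derivative blinfun_apply (h' x)) (at x)"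
    "continuous_on T h'" using h unfolding C1_on_def by blast
  have "continuous_on S (\<lambda>x. h' (f x))"
    by (rule continuous_on_compose2[OF h'(2) C1_on_imp_continuous_on[OF f] sub])
  then have "continuous_on S (\<lambda>x. h' (f x) o\<^sub>L f' x)"
    by (intro bounded_bilinear.continuous_on[OF bounded_bilinear_blinfun_compose] f')
  moreover have "((\<lambda>x. h (f x)) has_derivative blinfun_apply (h' (f x) o\<^sub>L f' x)) (at x)"
    if "x \<in> S" for x
  proof -
    have "f x \<in> T" using that sub by blast
    from has_derivative_compose[OF f'(1)[OF that] h'(1)[OF this]]
    show ?thesis by (simp add: o_def blinfun_compose.rep_eq)
  qed
  ultimately show ?thesis unfolding C1_on_def
    by (intro exI[of _ "\<lambda>x. h' (f x) o\<^sub>L f' x"] conjI ballI)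
qed

text \<open>Comparison with the harmonic series excludes summability, and unbounded monotone partial
  sums tend to infinity.\<close>

lemma partial_sums_at_top:
  fixes f :: "nat \<Rightarrow> real"
  assumes pos: "\<And>k. f k > 0" and order: "f \<in> \<Omega>(\<lambda>k. 1 / real k)"
  shows "filterlim (\<lambda>n. \<Sum>k<n. f k) at_top sequentially"
proof -
  have "\<not> summable f"
  proof
    assume f: "summable f"
    obtain c where c: "c > 0" "\<forall>\<^sub>F k in sequentially. norm (f k) \<ge> c * norm (1 / real k)"
      using landau_omega.bigE[OF order] by blast
    have "\<forall>\<^sub>F k in sequentially. norm (inverse (real k)) \<le> 1 / c * f k"
      using c(2)
    proof eventually_elim
      case (elim k)
      with c(1) pos[of k] show ?case by (simp add: field_simps)
    qed
    from summable_comparison_test_ev[OF this summable_mult[OF f]] show False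
      using not_summable_harmonic by blast
  qed
  moreover have "mono (\<lambda>n. \<Sum>k<n. f k)"
    using pos by (auto intro!: monoI sum_mono2 simp: less_imp_le)
  ultimately show ?thesis unfolding filterlim_at_top
  proof (intro allI)
    fix Z
    have "\<exists>N. Z \<le> (\<Sum>k<N. f k)"
    proof (rule ccontr)
      assume "\<not> ?thesis"
      then have "(\<Sum>k<n. f k) \<le> Z" for n by (simp add: not_le less_imp_le)
      with pos have "summable f" by (rule summableI_nonneg_bounded[OF less_imp_le])
      with \<open>\<not> summable f\<close> show False ..
    qed
    then obtain N where N: "Z \<le> (\<Sum>k<N. f k)" ..
    show "\<forall>\<^sub>F n in sequentially. Z \<le> (\<Sum>k<n. f k)"
      by (rule eventually_sequentiallyI[of N])
        (rule order_trans[OF N monoD[OF \<open>mono (\<lambda>n. \<Sum>k<n. f k)\<close>]])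
  qed
qed

text \<open>For a fixed time the hypothesis on the perturbation allows any Lipschitz constant close
  to 0; here that becomes a vanishing derivative.\<close>

lemma has_derivative_zero_if_lipschitz_zero:
  fixes f :: "'a::real_normed_vector \<Rightarrow> 'b::real_normed_vector"
  assumes "\<And>e. e > 0 \<Longrightarrow> \<exists>W. open W \<and> z \<in> W \<and> (\<forall>x\<in>W. norm (f x - f z) \<le> e * norm (x - z))"
  shows "(f has_derivative (\<lambda>_. 0)) (at z)"
  unfolding has_derivative_at_alt
proof (intro conjI allI impI)
  fix e :: real assume "e > 0"
  from assms[OF this] obtain W where W: "open W" "z \<in> W"
    "\<And>x. x \<in> W \<Longrightarrow> norm (f x - f z) \<le> e * norm (x - z)" by blast
  then obtain d where "d > 0" "ball z d \<subseteq> W" by (metis openE)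
  with W(3) show "\<exists>d>0. \<forall>y. norm (y - z) < d \<longrightarrow> norm (f y - f z - 0) \<le> e * norm (y - z)"
    by (intro exI[of _ d]) (auto simp: dist_norm norm_minus_commute subset_eq)
qed (rule bounded_linear_zero)

text \<open>Step 0 is the identity, unlike in \<open>iterate_maps\<close>, so
  \<open>orbit g k x\<close> is the point of the trajectory at time \<open>k\<close> and inductions
  start at \<open>x\<close> itself.\<close>

primrec orbit :: "(nat \<Rightarrow> 'a \<Rightarrow> 'a) \<Rightarrow> nat \<Rightarrow> 'a \<Rightarrow> 'a" where
  "orbit g 0 x = x"
| "orbit g (Suc k) x = g k (orbit g k x)"

lemma iterate_maps_eq_orbit: "iterate_maps g k 0 x = orbit g (Suc k) x"
  by (induction k) (simp_all add: iterate_maps_same iterate_maps_Suc)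

section \<open>The stable set of a uniformly hyperbolic system\<close>

text \<open>\<open>S\<close> collects the stable coordinates. A vector is at most twice its dominant
  part, so a perturbation with constant \<open>b k / 8\<close> costs at most \<open>b k / 4\<close>
  of that part, well below the rate \<open>b k\<close> of contraction and expansion.\<close>

locale hyperbolic_system =
  fixes S :: "'n::finite set" and a :: "nat \<Rightarrow> 'n \<Rightarrow> real" and b :: "nat \<Rightarrow> real"
    and \<eta> :: "nat \<Rightarrow> real^'n \<Rightarrow> real^'n" and R :: real
  assumes b_pos: "\<And>k. b k > 0" and b_le: "\<And>k. b k \<le> 1 / 2"
    and b_sum: "filterlim (\<lambda>n. \<Sum>k<n. b k) at_top sequentially"
    and a_contract: "\<And>k i. i \<in> S \<Longrightarrow> \<bar>a k i\<bar> \<le> 1 - b k"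
    and a_expand: "\<And>k i. i \<notin> S \<Longrightarrow> 1 + b k \<le> \<bar>a k i\<bar>"
    and R_pos: "R > 0"
    and lip: "\<And>k x y. norm x < R \<Longrightarrow> norm y < R \<Longrightarrow> norm (\<eta> k x - \<eta> k y) \<le> b k / 8 * norm (x - y)"
    and \<eta>_C1: "\<And>k. C1_on (\<eta> k) UNIV"
    and \<eta>_zero: "\<And>k. \<eta> k 0 = 0"
    and \<eta>_deriv_zero: "\<And>k. (\<eta> k has_derivative (\<lambda>_. 0)) (at 0)"
begin

abbreviation P :: "real^'n \<Rightarrow> real^'n" where "P \<equiv> coord_proj S"
abbreviation Q :: "real^'n \<Rightarrow> real^'n" where "Q \<equiv> coord_proj (- S)"

section \<open>The diagonal linear part and one-step cone estimates\<close>

definition A :: "nat \<Rightarrow> real^'n \<Rightarrow> real^'n" where "A k x = (\<chi> i. a k i * x $ i)"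

definition g :: "nat \<Rightarrow> real^'n \<Rightarrow> real^'n" where "g k x = A k x + \<eta> k x"

lemma linear_A: "linear (A k)"
  by (rule linearI) (auto simp: A_def vec_eq_iff algebra_simps)

lemma bounded_linear_A: "bounded_linear (A k)"
  by (simp add: linear_A linear_conv_bounded_linear[symmetric])

lemma g_zero: "g k 0 = 0"
  by (simp add: g_def \<eta>_zero linear_0[OF linear_A])

lemma proj_A: "coord_proj T (A k x) = A k (coord_proj T x)"
  by (auto simp: coord_proj_def A_def vec_eq_iff)

lemma norm_P_A: "norm (P (A k x)) \<le> (1 - b k) * norm (P x)"
proof -
  have b1: "1 - b k \<ge> 0" using b_le[of k] by simp
  have "norm (P (A k x)) \<le> norm ((1 - b k) *\<^sub>R P x)"
    by (rule norm_le_componentwise_cart)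
      (use b1 a_contract in \<open>auto simp: coord_proj_def A_def abs_mult intro!: mult_right_mono\<close>)
  then show ?thesis using b1 by simp
qed

lemma norm_Q_A: "(1 + b k) * norm (Q x) \<le> norm (Q (A k x))"
proof -
  have b1: "1 + b k \<ge> 0" using b_pos[of k] by simp
  have "norm ((1 + b k) *\<^sub>R Q x) \<le> norm (Q (A k x))"
    by (rule norm_le_componentwise_cart)
      (use b1 a_expand in \<open>auto simp: coord_proj_def A_def abs_mult intro!: mult_right_mono\<close>)
  then show ?thesis using b1 by simp
qed

lemma step_P:
  assumes "norm (d' - A k d) \<le> b k / 8 * norm d"
  shows "norm (P d') \<le> (1 - b k) * norm (P d) + b k / 8 * norm d"
proof -
  have "P d' = P (A k d) + P (d' - A k d)" by (simp add: coord_proj_linear_simps)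
  then have "norm (P d') \<le> norm (P (A k d)) + norm (P (d' - A k d))"
    by (metis norm_triangle_ineq)
  with norm_P_A[of k d] norm_coord_proj_le[of S "d' - A k d"] assms show ?thesis by linarith
qed

lemma step_Q:
  assumes "norm (d' - A k d) \<le> b k / 8 * norm d"
  shows "(1 + b k) * norm (Q d) - b k / 8 * norm d \<le> norm (Q d')"
proof -
  have "Q (A k d) = Q d' - Q (d' - A k d)" by (simp add: coord_proj_linear_simps)
  then have "norm (Q (A k d)) \<le> norm (Q d') + norm (Q (d' - A k d))"
    by (metis norm_triangle_ineq4)
  with norm_Q_A[of k d] norm_coord_proj_le[of "- S" "d' - A k d"] assms show ?thesis by linarith
qed

text \<open>With the unstable part dominant, the error is at most \<open>b k / 4\<close> of it: the
  new unstable part is at least \<open>1 + 3/4 * b k\<close> times the old one, the new stable part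
  at most \<open>1 - 3/4 * b k\<close> times it. The margin in the first conclusion later yields a
  strict inequality.\<close>

lemma step_expand:
  assumes d': "norm (d' - A k d) \<le> b k / 8 * norm d" and d: "norm (P d) \<le> norm (Q d)"
  shows "norm (P d') + b k * norm (Q d) \<le> norm (Q d')"
    and "(1 + b k / 2) * norm (Q d) \<le> norm (Q d')"
proof -
  have "b k / 8 * norm d \<le> b k / 8 * (2 * norm (Q d))"
    using norm_le_coord_proj[of d S] d b_pos[of k] by (intro mult_left_mono) auto
  moreover have "(1 - b k) * norm (P d) \<le> (1 - b k) * norm (Q d)"
    using d b_le[of k] by (intro mult_left_mono) auto
  moreover have "b k * norm (Q d) \<ge> 0" using b_pos[of k] by simp
  ultimately show "norm (P d') + b k * norm (Q d) \<le> norm (Q d')"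
    and "(1 + b k / 2) * norm (Q d) \<le> norm (Q d')"
    using step_P[OF d'] step_Q[OF d'] by (auto simp: algebra_simps)
qed

lemma step_contract:
  assumes d': "norm (d' - A k d) \<le> b k / 8 * norm d" and d: "norm (Q d) \<le> norm (P d)"
  shows "norm (P d') \<le> (1 - b k / 2) * norm (P d)"
proof -
  have "b k / 8 * norm d \<le> b k / 8 * (2 * norm (P d))"
    using norm_le_coord_proj[of d S] d b_pos[of k] by (intro mult_left_mono) auto
  moreover have "b k * norm (P d) \<ge> 0" using b_pos[of k] by simp
  ultimately show ?thesis using step_P[OF d'] by (auto simp: algebra_simps)
qed

text \<open>Differences of two orbits near the origin and orbits of the linearised system are both of this kind.\<close>

definition pseudo_orbit :: "(nat \<Rightarrow> real^'n) \<Rightarrow> bool"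
  where "pseudo_orbit d \<longleftrightarrow> (\<forall>k. norm (d (Suc k) - A k (d k)) \<le> b k / 8 * norm (d k))"

section \<open>Cone condition and decay for bounded pseudo-orbits\<close>

lemma pseudo_orbitD: "pseudo_orbit d \<Longrightarrow> norm (d (Suc k) - A k (d k)) \<le> b k / 8 * norm (d k)"
  by (simp add: pseudo_orbit_def)

text \<open>Once the unstable part dominates it does so forever, and it then grows without bound
  because the sums of \<open>b\<close> diverge.\<close>

lemma bounded_pseudo_orbit_cone:
  assumes d: "pseudo_orbit d" and bd: "\<And>k. norm (d k) \<le> C"
  shows "norm (Q (d j)) \<le> norm (P (d j))"
proof (rule ccontr)
  assume "\<not> norm (Q (d j)) \<le> norm (P (d j))"
  then have j: "norm (P (d j)) \<le> norm (Q (d j))" "norm (Q (d j)) > 0"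
    using norm_ge_zero[of "P (d j)"] by linarith+
  define q where "q = norm (Q (d j))"
  \<comment> \<open>A bound linear in the partial sums suffices: the unstable part never falls below
    \<open>q\<close>, so each step adds at least \<open>b k / 2 * q\<close>.\<close>
  have grow: "norm (P (d k)) \<le> norm (Q (d k)) \<and>
      q + q / 2 * (\<Sum>i = j..<k. b i) \<le> norm (Q (d k))" if "k \<ge> j" for k
    using that
  proof (induction k rule: dec_induct)
    case base
    show ?case using j by (simp add: q_def)
  next
    case (step k)
    have 1: "norm (P (d k)) \<le> norm (Q (d k))"
      and 2: "q + q / 2 * (\<Sum>i = j..<k. b i) \<le> norm (Q (d k))" using step by auto
    have "q / 2 * (\<Sum>i = j..<k. b i) \<ge> 0"
      using j b_pos by (intro mult_nonneg_nonneg sum_nonneg) (auto simp: q_def less_imp_le)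
    with 2 have "q \<le> norm (Q (d k))" by linarith
    then have "b k / 2 * q \<le> b k / 2 * norm (Q (d k))"
      using b_pos[of k] by (intro mult_left_mono) auto
    moreover have "b k * norm (Q (d k)) \<ge> 0" using b_pos[of k] by simp
    ultimately show ?case using step_expand[OF pseudo_orbitD[OF d] 1] 2 step(1)
      by (simp add: algebra_simps)
  qed
  obtain k where k: "k \<ge> j" "(\<Sum>i<k. b i) > (\<Sum>i<j. b i) + 2 * C / q"
  proof -
    have "\<forall>\<^sub>F k in sequentially. (\<Sum>i<k. b i) > (\<Sum>i<j. b i) + 2 * C / q"
      using b_sum by (simp add: filterlim_at_top_dense)
    then have "\<forall>\<^sub>F k in sequentially. k \<ge> j \<and> (\<Sum>i<k. b i) > (\<Sum>i<j. b i) + 2 * C / q"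
      using eventually_ge_at_top by (rule eventually_conj[rotated])
    then show ?thesis using that by (auto simp: eventually_sequentially)
  qed
  have "(\<Sum>i<k. b i) = (\<Sum>i<j. b i) + (\<Sum>i = j..<k. b i)"
    using k(1) by (metis atLeast0LessThan sum.atLeastLessThan_concat zero_le)
  with k(2) have "(\<Sum>i = j..<k. b i) > 2 * C / q" by linarith
  then have "q / 2 * (\<Sum>i = j..<k. b i) > C" using j by (simp add: q_def field_simps)
  moreover have "q \<ge> 0" by (simp add: q_def)
  ultimately show False
    using grow[OF k(1)] bd[of k] norm_coord_proj_le[of "- S" "d k"] by linarith
qed

lemma cone_pseudo_orbit_antimono:
  assumes d: "pseudo_orbit d" and c: "\<And>k. norm (Q (d k)) \<le> norm (P (d k))"
  shows "norm (P (d k)) \<le> norm (P (d 0))"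
proof (induction k)
  case (Suc k)
  have "b k * norm (P (d k)) \<ge> 0" using b_pos[of k] by simp
  with step_contract[OF pseudo_orbitD[OF d] c, of k] Suc show ?case by (simp add: algebra_simps)
qed simp

lemma cone_pseudo_orbit_bound:
  assumes d: "pseudo_orbit d" and c: "\<And>k. norm (Q (d k)) \<le> norm (P (d k))"
  shows "norm (d k) \<le> 2 * norm (P (d 0))"
  using cone_pseudo_orbit_antimono[OF assms, of k] c[of k] norm_le_coord_proj[of "d k" S] by linarith

text \<open>Each contraction factor \<open>1 - b k / 2\<close> is at most
  \<open>exp (- (b k / 2))\<close>, so divergence of the sums sends the stable part to 0; the cone
  drags the unstable part along.\<close>

lemma cone_pseudo_orbit_tendsto:
  assumes d: "pseudo_orbit d" and c: "\<And>k. norm (Q (d k)) \<le> norm (P (d k))"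
  shows "d \<longlonglongrightarrow> 0"
proof -
  let ?C = "norm (P (d 0))"
  have bound: "norm (P (d k)) \<le> ?C * exp (- ((\<Sum>i<k. b i) / 2))" for k
  proof (induction k)
    case (Suc k)
    have "norm (P (d (Suc k))) \<le> (1 - b k / 2) * norm (P (d k))"
      by (rule step_contract[OF pseudo_orbitD[OF d] c])
    also have "\<dots> \<le> exp (- (b k / 2)) * norm (P (d k))"
      using exp_ge_add_one_self[of "- (b k / 2)"] by (intro mult_right_mono) auto
    also have "\<dots> \<le> exp (- (b k / 2)) * (?C * exp (- ((\<Sum>i<k. b i) / 2)))"
      using Suc by (intro mult_left_mono) auto
    also have "\<dots> = ?C * exp (- ((\<Sum>i<Suc k. b i) / 2))"
      by (simp add: exp_add[symmetric] add_divide_distrib)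
    finally show ?case .
  qed simp
  have "filterlim (\<lambda>k. (\<Sum>i<k. b i) * (1 / 2)) at_top sequentially"
    by (rule filterlim_at_top_mult_tendsto_pos[OF tendsto_const _ b_sum, of "1 / 2"]) simp
  then have "filterlim (\<lambda>k. - ((\<Sum>i<k. b i) / 2)) at_bot sequentially"
    by (simp add: filterlim_uminus_at_top)
  then have "(\<lambda>k. exp (- ((\<Sum>i<k. b i) / 2))) \<longlonglongrightarrow> 0"
    by (rule filterlim_compose[OF exp_at_bot])
  then have lim: "(\<lambda>k. 2 * (?C * exp (- ((\<Sum>i<k. b i) / 2)))) \<longlonglongrightarrow> 0"
    by (intro tendsto_mult_right_zero)
  show ?thesis
  proof (rule Lim_null_comparison[OF always_eventually lim], rule allI)
    fix k
    show "norm (d k) \<le> 2 * (?C * exp (- ((\<Sum>i<k. b i) / 2)))"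
      using bound[of k] c[of k] norm_le_coord_proj[of "d k" S] by linarith
  qed
qed

section \<open>The stable set and its cone property\<close>

text \<open>Stated through the cone rather than through small orbits, because at each time the cone
  is a closed condition and survives limits. \<open>V_orbit_ball\<close> and
  \<open>orbit_in_ball_imp_V\<close> give the link to orbits staying near the origin.\<close>

definition V :: "(real^'n) set"
  where "V = {x. norm (P x) < R / 2 \<and> (\<forall>k. norm (Q (orbit g k x)) \<le> norm (P (orbit g k x)))}"

lemma in_ball: "norm (P x) < R / 2 \<Longrightarrow> norm (Q x) \<le> norm (P x) \<Longrightarrow> norm x < R"
  using norm_le_coord_proj[of x S] by linarith

lemma g_diff:
  assumes "norm x < R" "norm y < R"
  shows "norm (g k x - g k y - A k (x - y)) \<le> b k / 8 * norm (x - y)"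
proof -
  have "g k x - g k y - A k (x - y) = \<eta> k x - \<eta> k y"
    by (simp add: g_def linear_diff[OF linear_A])
  with lip[OF assms] show ?thesis by simp
qed

lemma g_step:
  assumes "norm x < R"
  shows "norm (g k x - A k x) \<le> b k / 8 * norm x"
  using g_diff[OF assms, of 0] R_pos by (simp add: g_zero)

lemma orbit_zero: "orbit g k 0 = 0"
  by (induction k) (simp_all add: g_zero)

text \<open>The estimates hold only in the ball of radius \<open>R\<close>; the induction hypothesis
  together with the cone keeps the orbit there.\<close>

lemma V_orbit_P:
  assumes "x \<in> V"
  shows "norm (P (orbit g k x)) \<le> norm (P x)"
proof (induction k)
  case (Suc k)
  have c: "norm (Q (orbit g k x)) \<le> norm (P (orbit g k x))" using assms by (simp add: V_def)
  moreover have "norm (P (orbit g k x)) < R / 2" using Suc assms by (simp add: V_def)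
  ultimately have "norm (orbit g k x) < R" by (intro in_ball)
  from step_contract[OF g_step[OF this] c, of k] have
    "norm (P (orbit g (Suc k) x)) \<le> (1 - b k / 2) * norm (P (orbit g k x))" by simp
  moreover have "b k * norm (P (orbit g k x)) \<ge> 0" using b_pos[of k] by simp
  ultimately show ?case using Suc by (simp add: algebra_simps)
qed simp

lemma V_orbit_ball:
  assumes "x \<in> V"
  shows "norm (orbit g k x) < R"
proof (rule in_ball)
  show "norm (P (orbit g k x)) < R / 2"
    using V_orbit_P[OF assms, of k] assms by (simp add: V_def)
  show "norm (Q (orbit g k x)) \<le> norm (P (orbit g k x))" using assms by (simp add: V_def)
qed

lemma pseudo_orbit_diff:
  assumes "\<And>k. norm (orbit g k x) < R" "\<And>k. norm (orbit g k y) < R"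
  shows "pseudo_orbit (\<lambda>k. orbit g k x - orbit g k y)"
  using g_diff[OF assms] by (simp add: pseudo_orbit_def)

lemma zero_in_V: "0 \<in> V"
  using R_pos by (simp add: V_def orbit_zero coord_proj_linear_simps)

lemma orbit_in_ball_imp_V:
  assumes "norm (P x) < R / 2" "\<And>k. norm (orbit g k x) < R"
  shows "x \<in> V"
proof -
  have "pseudo_orbit (\<lambda>k. orbit g k x - orbit g k 0)"
    by (rule pseudo_orbit_diff) (use assms in \<open>simp_all add: orbit_zero R_pos\<close>)
  from bounded_pseudo_orbit_cone[OF this, of R] assms show ?thesis
    by (simp add: V_def orbit_zero less_imp_le)
qed

lemma V_orbit_tendsto:
  assumes "x \<in> V"
  shows "(\<lambda>k. orbit g k x) \<longlonglongrightarrow> 0"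
proof -
  have "pseudo_orbit (\<lambda>k. orbit g k x - orbit g k 0)"
    by (rule pseudo_orbit_diff) (use assms in \<open>simp_all add: V_orbit_ball zero_in_V\<close>)
  from cone_pseudo_orbit_tendsto[OF this] assms show ?thesis
    by (simp add: V_def orbit_zero)
qed

text \<open>Both orbits stay in the ball, so their difference is a bounded pseudo-orbit. At time 0
  this makes \<open>V\<close> a 1-Lipschitz graph over the stable coordinates.\<close>

lemma V_diff_cone:
  assumes "x \<in> V" "y \<in> V"
  shows "norm (Q (orbit g k x - orbit g k y)) \<le> norm (P (orbit g k x - orbit g k y))"
proof (rule bounded_pseudo_orbit_cone[where C = "2 * R"])
  show "pseudo_orbit (\<lambda>k. orbit g k x - orbit g k y)"
    by (rule pseudo_orbit_diff) (use assms in \<open>simp_all add: V_orbit_ball\<close>)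
  fix k
  show "norm (orbit g k x - orbit g k y) \<le> 2 * R"
    using V_orbit_ball[OF assms(1), of k] V_orbit_ball[OF assms(2), of k]
      norm_triangle_ineq4[of "orbit g k x" "orbit g k y"] by linarith
qed

section \<open>Graph transform: pulling graphs back along the maps\<close>

text \<open>A 1-Lipschitz map from stable to unstable coordinates, written on the whole space:
  within radius \<open>R / 2\<close> the bound by \<open>P x - P y\<close> forces dependence on
  \<open>P x\<close> alone. Its graph consists of the points \<open>P x + \<phi> x\<close>.\<close>

definition graph_map :: "(real^'n \<Rightarrow> real^'n) \<Rightarrow> bool"
  where "graph_map \<phi> \<longleftrightarrow> \<phi> 0 = 0 \<and> (\<forall>x. P (\<phi> x) = 0) \<and>
    (\<forall>x y. norm (P x) < R / 2 \<longrightarrow> norm (P y) < R / 2 \<longrightarrow> norm (\<phi> x - \<phi> y) \<le> norm (P x - P y))"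

lemma graph_map_norm: "graph_map \<phi> \<Longrightarrow> norm (P x) < R / 2 \<Longrightarrow> norm (\<phi> x) \<le> norm (P x)"
  unfolding graph_map_def using R_pos
  by (elim conjE allE[of _ x] allE[of _ 0]) (simp add: coord_proj_linear_simps)

lemma Q_of_P_zero: "P u = 0 \<Longrightarrow> Q u = u"
  using coord_proj_add_compl[of S u] by simp

definition A_inv :: "nat \<Rightarrow> real^'n \<Rightarrow> real^'n"
  where "A_inv k v = (\<chi> i. if i \<in> S then 0 else v $ i / a k i)"

lemma norm_A_inv_le: "norm (A_inv k v) \<le> norm v"
proof (rule norm_le_componentwise_cart)
  fix i
  show "norm (A_inv k v $ i) \<le> norm (v $ i)"
  proof (cases "i \<in> S")
    case False
    have "\<bar>a k i\<bar> \<ge> 1" using a_expand[OF False, of k] b_pos[of k] by linarith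
    then have "\<bar>v $ i\<bar> * 1 \<le> \<bar>v $ i\<bar> * \<bar>a k i\<bar>" by (intro mult_left_mono) auto
    with False \<open>\<bar>a k i\<bar> \<ge> 1\<close> show ?thesis
      by (simp add: A_inv_def abs_divide divide_le_eq)
  qed (simp add: A_inv_def)
qed

lemma A_inv_diff: "A_inv k v - A_inv k w = A_inv k (v - w)"
  by (simp add: A_inv_def vec_eq_iff diff_divide_distrib)

lemma A_A_inv: "A k (A_inv k v) = Q v"
proof -
  have "a k i \<noteq> 0" if "i \<notin> S" for i using a_expand[OF that, of k] b_pos[of k] by auto
  then show ?thesis by (simp add: A_def A_inv_def coord_proj_def vec_eq_iff)
qed

lemma P_A_inv: "P (A_inv k v) = 0"
  by (simp add: A_inv_def coord_proj_def vec_eq_iff)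

lemma g_contract:
  assumes "norm (P x) < R / 2" "norm (Q x) \<le> norm (P x)"
  shows "norm (P (g k x)) \<le> (1 - b k / 2) * norm (P x)" "norm (P (g k x)) < R / 2"
proof -
  show 1: "norm (P (g k x)) \<le> (1 - b k / 2) * norm (P x)"
    by (rule step_contract[OF g_step[OF in_ball[OF assms]] assms(2)])
  have "b k * norm (P x) \<ge> 0" using b_pos[of k] by simp
  with 1 assms(1) show "norm (P (g k x)) < R / 2" by (simp add: algebra_simps)
qed

text \<open>Solving \<open>A k u + Q (\<eta> k (P x + u)) = \<phi> (g k (P x + u))\<close> for the
  linear term gives the fixed point equation of \<open>?T\<close>. This is a contraction:
  \<open>A_inv\<close> does not expand, and a change of \<open>u\<close> moves the stable part of
  the image only through \<open>\<eta>\<close>.\<close>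

lemma graph_preimage_point:
  assumes \<phi>: "graph_map \<phi>" and x: "norm (P x) < R / 2"
  shows "\<exists>u. P u = 0 \<and> norm u \<le> norm (P x) \<and> Q (g k (P x + u)) = \<phi> (g k (P x + u))"
proof -
  let ?B = "{u. P u = 0 \<and> norm u \<le> norm (P x)}"
  let ?T = "\<lambda>u. A_inv k (\<phi> (g k (P x + u)) - \<eta> k (P x + u))"
  have PQ: "P (P x + u) = P x" "Q (P x + u) = u" if "u \<in> ?B" for u
    using that by (auto simp: coord_proj_linear_simps Q_of_P_zero)
  have ball: "norm (P x + u) < R" if "u \<in> ?B" for u
    using PQ[OF that] that x by (intro in_ball) auto
  have gb: "norm (P (g k (P x + u))) \<le> (1 - b k / 2) * norm (P x)"
    "norm (P (g k (P x + u))) < R / 2" if "u \<in> ?B" for u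
    using g_contract[of "P x + u" k] PQ[OF that] that x by auto
  have "\<exists>!u. u \<in> ?B \<and> ?T u = u"
  proof (rule Banach_fix)
    have "closed ((\<lambda>u. P u) -` {0} \<inter> cball 0 (norm (P x)))"
      by (intro closed_Int closed_vimage closed_cball continuous_on_coord_proj) simp
    moreover have "(\<lambda>u. P u) -` {0} \<inter> cball 0 (norm (P x)) = ?B" by auto
    ultimately have "closed ?B" by simp
    then show "complete ?B" by (simp add: complete_eq_closed)
    show "?B \<noteq> {}" by (auto intro!: exI[of _ 0] simp: coord_proj_linear_simps)
    show "(0::real) \<le> 1 / 2" "(1 / 2 :: real) < 1" by auto
    show "?T ` ?B \<subseteq> ?B"
    proof safe
      fix u assume u: "P u = 0" "norm u \<le> norm (P x)"
      show "P (?T u) = 0" by (rule P_A_inv)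
      have uB: "u \<in> ?B" using u by simp
      \<comment> \<open>In units of \<open>norm (P x)\<close> the graph contributes at most
        \<open>1 - b k / 2\<close> and the perturbation at most \<open>b k / 4\<close>, so
        \<open>?T\<close> preserves the ball.\<close>
      have "norm (\<phi> (g k (P x + u))) \<le> (1 - b k / 2) * norm (P x)"
        using graph_map_norm[OF \<phi> gb(2)[OF uB]] gb(1)[OF uB] by linarith
      moreover have "norm (\<eta> k (P x + u)) \<le> b k / 8 * norm (P x + u)"
        using lip[OF ball[OF uB], of 0] R_pos by (simp add: \<eta>_zero)
      moreover have "b k / 8 * norm (P x + u) \<le> b k / 8 * (2 * norm (P x))"
        using norm_triangle_ineq[of "P x" u] u b_pos[of k] by (intro mult_left_mono) auto
      moreover have "b k * norm (P x) \<ge> 0" using b_pos[of k] by simp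
      moreover have "norm (?T u) \<le> norm (\<phi> (g k (P x + u))) + norm (\<eta> k (P x + u))"
        using norm_A_inv_le norm_triangle_ineq4 order_trans by blast
      ultimately show "norm (?T u) \<le> norm (P x)" by (simp add: algebra_simps)
    qed
    show "dist (?T u) (?T v) \<le> 1 / 2 * dist u v" if "u \<in> ?B" "v \<in> ?B" for u v
    proof -
      let ?u = "P x + u" and ?v = "P x + v"
      have \<eta>: "norm (\<eta> k ?u - \<eta> k ?v) \<le> b k / 8 * norm (u - v)"
        using lip[OF ball[OF that(1)] ball[OF that(2)], of k] by simp
      have "P (g k ?u) - P (g k ?v) = P (A k (u - v)) + P (\<eta> k ?u - \<eta> k ?v)"
        by (simp add: g_def coord_proj_linear_simps linear_add[OF linear_A] linear_diff[OF linear_A])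
      also have "P (A k (u - v)) = 0"
        using that by (simp add: proj_A coord_proj_linear_simps linear_0[OF linear_A])
      finally have "norm (P (g k ?u) - P (g k ?v)) \<le> norm (\<eta> k ?u - \<eta> k ?v)"
        using norm_coord_proj_le[of S "\<eta> k ?u - \<eta> k ?v"] by simp
      moreover have "norm (\<phi> (g k ?u) - \<phi> (g k ?v)) \<le> norm (P (g k ?u) - P (g k ?v))"
        using \<phi> gb(2)[OF that(1)] gb(2)[OF that(2)] unfolding graph_map_def by blast
      moreover have "norm (?T u - ?T v) \<le> norm (\<phi> (g k ?u) - \<phi> (g k ?v)) + norm (\<eta> k ?u - \<eta> k ?v)"
      proof -
        have "norm (?T u - ?T v) \<le> norm ((\<phi> (g k ?u) - \<eta> k ?u) - (\<phi> (g k ?v) - \<eta> k ?v))"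
          unfolding A_inv_diff by (rule norm_A_inv_le)
        also have "\<dots> = norm ((\<phi> (g k ?u) - \<phi> (g k ?v)) - (\<eta> k ?u - \<eta> k ?v))"
          by (simp add: algebra_simps)
        also have "\<dots> \<le> norm (\<phi> (g k ?u) - \<phi> (g k ?v)) + norm (\<eta> k ?u - \<eta> k ?v)"
          by (rule norm_triangle_ineq4)
        finally show ?thesis .
      qed
      \<comment> \<open>The difference of the graph values and that of the perturbations are each at
        most a quarter of \<open>norm (u - v)\<close>, hence the factor 1/2.\<close>
      moreover have "b k / 8 * norm (u - v) \<le> 1 / 4 * norm (u - v)"
        using b_le[of k] by (intro mult_right_mono) auto
      ultimately show ?thesis using \<eta> by (simp add: dist_norm)
    qed
  qed
  then obtain u where u: "u \<in> ?B" "?T u = u" by blast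
  have "Q (g k (P x + u)) = A k u + Q (\<eta> k (P x + u))"
    using PQ(2)[OF u(1)] by (simp add: g_def coord_proj_linear_simps proj_A)
  also have "A k u = A k (?T u)" using u(2) by simp
  also have "\<dots> = Q (\<phi> (g k (P x + u))) - Q (\<eta> k (P x + u))"
    by (simp add: A_A_inv coord_proj_linear_simps)
  also have "Q (\<phi> (g k (P x + u))) = \<phi> (g k (P x + u))"
    using \<phi> by (simp add: graph_map_def Q_of_P_zero)
  finally have "Q (g k (P x + u)) = \<phi> (g k (P x + u))" by simp
  with u(1) show ?thesis by blast
qed

text \<open>The pointwise solutions form a 1-Lipschitz map: two of them violating the bound would
  differ by a vector outside the cone, \<open>step_expand\<close> would put the difference of the
  images strictly outside, and the bound for \<open>\<phi>\<close> would fail.\<close>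

lemma graph_preimage:
  assumes \<phi>: "graph_map \<phi>"
  shows "\<exists>\<psi>. graph_map \<psi> \<and> (\<forall>x. norm (P x) < R / 2 \<longrightarrow>
    Q (g k (P x + \<psi> x)) = \<phi> (g k (P x + \<psi> x)))"
proof -
  \<comment> \<open>Outside the domain 0 is admissible, so the choice is total; over 0 the norm
    bound forces \<open>\<psi> 0 = 0\<close>.\<close>
  define good where "good x u \<longleftrightarrow> P u = 0 \<and> norm u \<le> norm (P x) \<and>
    (norm (P x) < R / 2 \<longrightarrow> Q (g k (P x + u)) = \<phi> (g k (P x + u)))" for x u
  have "\<exists>u. good x u" for x
  proof (cases "norm (P x) < R / 2")
    case True
    with graph_preimage_point[OF \<phi> True, of k] show ?thesis unfolding good_def by blast
  next
    case False
    then show ?thesis unfolding good_def by (auto intro!: exI[of _ 0] simp: coord_proj_linear_simps)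
  qed
  then obtain \<psi> where \<psi>: "\<And>x. good x (\<psi> x)" by metis
  have "graph_map \<psi>" unfolding graph_map_def
  proof (intro conjI allI impI)
    show "\<psi> 0 = 0" using \<psi>[of 0] by (simp add: good_def coord_proj_linear_simps)
    show "P (\<psi> x) = 0" for x using \<psi>[of x] by (simp add: good_def)
    fix x y assume xy: "norm (P x) < R / 2" "norm (P y) < R / 2"
    let ?x = "P x + \<psi> x" and ?y = "P y + \<psi> y"
    have PQ: "P (P z + \<psi> z) = P z" "Q (P z + \<psi> z) = \<psi> z" for z
      using \<psi>[of z] by (auto simp: good_def coord_proj_linear_simps Q_of_P_zero)
    have cone: "norm (Q (P z + \<psi> z)) \<le> norm (P (P z + \<psi> z))" for z
      unfolding PQ using \<psi>[of z] by (simp add: good_def)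
    have ball: "norm ?x < R" "norm ?y < R" using cone xy by (auto intro!: in_ball simp: PQ)
    have gb: "norm (P (g k ?x)) < R / 2" "norm (P (g k ?y)) < R / 2"
      using g_contract(2)[OF _ cone] xy unfolding PQ by blast+
    show "norm (\<psi> x - \<psi> y) \<le> norm (P x - P y)"
    proof (rule ccontr)
      assume neg: "\<not> norm (\<psi> x - \<psi> y) \<le> norm (P x - P y)"
      have d: "P (?x - ?y) = P x - P y" "Q (?x - ?y) = \<psi> x - \<psi> y"
        by (simp_all only: linear_diff[OF linear_coord_proj] PQ)
      have "norm (P (g k ?x - g k ?y)) + b k * norm (Q (?x - ?y)) \<le> norm (Q (g k ?x - g k ?y))"
        by (rule step_expand(1)[OF g_diff[OF ball]]) (use neg in \<open>simp only: d\<close>)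
      moreover have "norm (Q (g k ?x - g k ?y)) = norm (\<phi> (g k ?x) - \<phi> (g k ?y))"
        using \<psi>[of x] \<psi>[of y] xy by (simp add: linear_diff[OF linear_coord_proj] good_def)
      moreover have "norm (\<phi> (g k ?x) - \<phi> (g k ?y)) \<le> norm (P (g k ?x - g k ?y))"
        using \<phi> gb unfolding graph_map_def by (simp add: linear_diff[OF linear_coord_proj])
      moreover have "b k * norm (Q (?x - ?y)) > 0"
      proof -
        have "norm (Q (?x - ?y)) > 0" unfolding d using neg norm_ge_zero[of "P x - P y"] by linarith
        then show ?thesis using b_pos[of k] by simp
      qed
      ultimately show False by linarith
    qed
  qed
  with \<psi> show ?thesis unfolding good_def by blast
qed

text \<open>The last map is pulled back first, hence the generalisation over \<open>\<phi>\<close>: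
  the induction hypothesis is applied to the graph that \<open>g n\<close> sends into the given
  one.\<close>

lemma graph_pullback:
  assumes "graph_map \<phi>"
  shows "\<exists>\<psi>. graph_map \<psi> \<and> (\<forall>x. norm (P x) < R / 2 \<longrightarrow>
    (\<forall>k\<le>n. norm (Q (orbit g k (P x + \<psi> x))) \<le> norm (P (orbit g k (P x + \<psi> x))) \<and>
      norm (P (orbit g k (P x + \<psi> x))) < R / 2) \<and>
    Q (orbit g n (P x + \<psi> x)) = \<phi> (orbit g n (P x + \<psi> x)))"
  using assms
proof (induction n arbitrary: \<phi>)
  case 0
  have "P (P x + \<phi> x) = P x" "Q (P x + \<phi> x) = \<phi> x" for x
    using 0 by (auto simp: graph_map_def coord_proj_linear_simps Q_of_P_zero)
  moreover have "\<phi> (P x + \<phi> x) = \<phi> x" if "norm (P x) < R / 2" for x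
  proof -
    have "norm (\<phi> (P x + \<phi> x) - \<phi> x) \<le> norm (P (P x + \<phi> x) - P x)"
      using 0 that calculation(1)[of x] unfolding graph_map_def by metis
    then show ?thesis using calculation(1)[of x] by simp
  qed
  ultimately show ?case using 0 graph_map_norm[OF 0] by (intro exI[of _ \<phi>]) auto
next
  case (Suc n)
  obtain \<phi>' where \<phi>': "graph_map \<phi>'" "\<And>x. norm (P x) < R / 2 \<Longrightarrow>
    Q (g n (P x + \<phi>' x)) = \<phi> (g n (P x + \<phi>' x))"
    using graph_preimage[OF Suc.prems] by blast
  obtain \<psi> where \<psi>: "graph_map \<psi>" and orb: "\<And>x k. norm (P x) < R / 2 \<Longrightarrow> k \<le> n \<Longrightarrow>
      norm (Q (orbit g k (P x + \<psi> x))) \<le> norm (P (orbit g k (P x + \<psi> x))) \<and>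
      norm (P (orbit g k (P x + \<psi> x))) < R / 2"
    and fin: "\<And>x. norm (P x) < R / 2 \<Longrightarrow> Q (orbit g n (P x + \<psi> x)) = \<phi>' (orbit g n (P x + \<psi> x))"
    using Suc.IH[OF \<phi>'(1)] by blast
  have last: "norm (Q (g n z)) \<le> norm (P (g n z)) \<and> norm (P (g n z)) < R / 2 \<and> Q (g n z) = \<phi> (g n z)"
    if "norm (P x) < R / 2" "z = orbit g n (P x + \<psi> x)" for x z
  proof -
    have z: "norm (P z) < R / 2" "norm (Q z) \<le> norm (P z)" "Q z = \<phi>' z"
      using orb[OF that(1) le_refl] fin[OF that(1)] that(2) by auto
    have "z = P z + \<phi>' z" using coord_proj_add_compl[of S z] z(3) by simp
    with \<phi>'(2)[OF z(1)] have q: "Q (g n z) = \<phi> (g n z)" by simp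
    with graph_map_norm[OF Suc.prems g_contract(2)[OF z(1,2)], of n] g_contract(2)[OF z(1,2), of n]
    show ?thesis by simp
  qed
  show ?case
    by (intro exI[of _ \<psi>] conjI \<psi> allI impI) (use orb last in \<open>fastforce simp: le_Suc_eq\<close>)+
qed

lemma continuous_\<eta>: "continuous_on UNIV (\<eta> k)"
  by (rule C1_on_imp_continuous_on[OF \<eta>_C1])

lemma continuous_orbit: "continuous_on UNIV (orbit g k)"
proof (induction k)
  case (Suc k)
  have "continuous_on UNIV (g k)"
    unfolding g_def
    by (intro continuous_on_add continuous_\<eta> linear_continuous_on bounded_linear_A)
  from continuous_on_compose2[OF this Suc] show ?case by simp
qed (simp add: id_def)

lemma tendsto_orbit: "(s \<longlongrightarrow> x) F \<Longrightarrow> ((\<lambda>n. orbit g k (s n)) \<longlongrightarrow> orbit g k x) F"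
  using continuous_orbit[of k] by (simp add: continuous_on_eq_continuous_at isCont_tendsto_compose)

text \<open>Pulling the zero graph back yields, for every \<open>n\<close>, a point over
  \<open>P x\<close> whose orbit respects the cone up to time \<open>n\<close>. These points are
  bounded, and a subsequence converges to one respecting it at all times.\<close>

lemma V_exists:
  assumes x: "norm (P x) < R / 2"
  shows "\<exists>z\<in>V. P z = P x"
proof -
  have "graph_map (\<lambda>_. 0)" by (simp add: graph_map_def coord_proj_linear_simps)
  from graph_pullback[OF this] obtain \<psi> where \<psi>: "\<And>n. graph_map (\<psi> n)"
    "\<And>n k. k \<le> n \<Longrightarrow> norm (Q (orbit g k (P x + \<psi> n x))) \<le> norm (P (orbit g k (P x + \<psi> n x)))"
    using x by metis
  let ?z = "\<lambda>n. P x + \<psi> n x"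
  have "norm (?z n) \<le> 2 * norm (P x)" for n
    using graph_map_norm[OF \<psi>(1) x, of n] norm_triangle_ineq[of "P x" "\<psi> n x"] by linarith
  then have "bounded (range ?z)" by (auto simp: bounded_iff)
  then obtain z r where r: "strict_mono r" "(?z \<circ> r) \<longlonglongrightarrow> z"
    using bounded_imp_convergent_subsequence by blast
  have "P (?z n) = P x" for n using \<psi>(1)[of n] by (simp add: graph_map_def coord_proj_linear_simps)
  with tendsto_coord_proj[OF r(2), of S] have Pz: "P z = P x"
    by (simp add: o_def LIMSEQ_const_iff)
  have "norm (Q (orbit g k z)) \<le> norm (P (orbit g k z))" for k
  proof (rule tendsto_le)
    show "(\<lambda>n. norm (Q (orbit g k ((?z \<circ> r) n)))) \<longlonglongrightarrow> norm (Q (orbit g k z))"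
      "(\<lambda>n. norm (P (orbit g k ((?z \<circ> r) n)))) \<longlonglongrightarrow> norm (P (orbit g k z))"
      by (intro tendsto_norm tendsto_coord_proj tendsto_orbit r(2))+
    show "\<forall>\<^sub>F n in sequentially. norm (Q (orbit g k ((?z \<circ> r) n))) \<le> norm (P (orbit g k ((?z \<circ> r) n)))"
      using eventually_ge_at_top[of k]
    proof eventually_elim
      case (elim n)
      then have "k \<le> r n" using seq_suble[OF r(1), of n] by linarith
      then show ?case using \<psi>(2) by simp
    qed
  qed simp
  with x Pz have "z \<in> V" by (simp add: V_def)
  with Pz show ?thesis by blast
qed

subsection \<open>Smoothness\<close>

definition D\<eta> :: "nat \<Rightarrow> real^'n \<Rightarrow> (real^'n) \<Rightarrow>\<^sub>L (real^'n)"
  where "D\<eta> k = (SOME f'. (\<forall>x. (\<eta> k has_derivative blinfun_apply (f' x)) (at x)) \<and> continuous_on UNIV f')"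

lemma \<eta>_has_derivative: "(\<eta> k has_derivative blinfun_apply (D\<eta> k x)) (at x)"
  and continuous_D\<eta>: "continuous_on UNIV (D\<eta> k)"
proof -
  have "\<exists>f' :: real^'n \<Rightarrow> (real^'n) \<Rightarrow>\<^sub>L (real^'n).
      (\<forall>x. (\<eta> k has_derivative blinfun_apply (f' x)) (at x)) \<and> continuous_on UNIV f'"
    using \<eta>_C1[of k] unfolding C1_on_def by simp
  from someI_ex[OF this] show "(\<eta> k has_derivative blinfun_apply (D\<eta> k x)) (at x)"
    "continuous_on UNIV (D\<eta> k)" unfolding D\<eta>_def[symmetric] by auto
qed

lemma D\<eta>_zero: "blinfun_apply (D\<eta> k 0) v = 0"
  using has_derivative_unique[OF \<eta>_has_derivative \<eta>_deriv_zero, of k] by (simp add: fun_eq_iff)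

lemma norm_D\<eta>_le:
  assumes "norm x < R"
  shows "norm (blinfun_apply (D\<eta> k x) v) \<le> b k / 8 * norm v"
  by (rule has_derivative_norm_bound[OF \<eta>_has_derivative, of "ball 0 R"])
    (use assms lip in auto)

text \<open>The variational equation along the orbit of \<open>x\<close>, as a recursion so that the
  pseudo-orbit estimate can be read off step by step.\<close>

primrec orbit_deriv :: "nat \<Rightarrow> real^'n \<Rightarrow> real^'n \<Rightarrow> real^'n" where
  "orbit_deriv 0 x v = v"
| "orbit_deriv (Suc k) x v =
    A k (orbit_deriv k x v) + blinfun_apply (D\<eta> k (orbit g k x)) (orbit_deriv k x v)"

lemma orbit_has_derivative: "(orbit g k has_derivative orbit_deriv k x) (at x)"
proof (induction k)
  case 0
  have "orbit g 0 = (\<lambda>x. x)" "orbit_deriv 0 x = (\<lambda>v. v)" by (auto simp: fun_eq_iff)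
  then show ?case by simp
next
  case (Suc k)
  have "(A k has_derivative A k) (at (orbit g k x))"
    by (rule bounded_linear_imp_has_derivative[OF bounded_linear_A])
  from has_derivative_add[OF this \<eta>_has_derivative[of k "orbit g k x"]]
  have "(g k has_derivative (\<lambda>v. A k v + blinfun_apply (D\<eta> k (orbit g k x)) v)) (at (orbit g k x))"
    unfolding g_def .
  from has_derivative_compose[OF Suc this] show ?case by simp
qed

lemma tendsto_orbit_deriv:
  assumes "(s \<longlongrightarrow> x) F" "(w \<longlongrightarrow> v) F"
  shows "((\<lambda>n. orbit_deriv k (s n) (w n)) \<longlongrightarrow> orbit_deriv k x v) F"
proof (induction k)
  case 0
  show ?case using assms by simp
next
  case (Suc k)
  have "((\<lambda>n. D\<eta> k (orbit g k (s n))) \<longlongrightarrow> D\<eta> k (orbit g k x)) F"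
    by (rule isCont_tendsto_compose[OF _ tendsto_orbit[OF assms(1)]])
      (use continuous_D\<eta>[of k] in \<open>simp add: continuous_on_eq_continuous_at\<close>)
  then show ?case
    by (auto intro!: tendsto_add blinfun.tendsto Suc bounded_linear.tendsto[OF bounded_linear_A])
qed

lemma linear_orbit_deriv: "linear (orbit_deriv k x)"
  using orbit_has_derivative[of k x] has_derivative_bounded_linear bounded_linear.linear by blast

section \<open>Stable directions\<close>

text \<open>Boundedness makes this a subspace; over points of \<open>V\<close> it is equivalent to
  the cone condition at all times (\<open>stable_dir_iff_cone\<close>), the form that passes to
  limits.\<close>

definition stable_dir :: "real^'n \<Rightarrow> (real^'n) set"
  where "stable_dir z = {v. \<exists>C. \<forall>k. norm (orbit_deriv k z v) \<le> C}"

lemma subspace_stable_dir: "subspace (stable_dir z)"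
proof (rule subspaceI)
  show "0 \<in> stable_dir z"
    by (auto simp: stable_dir_def linear_0[OF linear_orbit_deriv])
next
  fix v w assume "v \<in> stable_dir z" "w \<in> stable_dir z"
  then obtain B C where "\<And>k. norm (orbit_deriv k z v) \<le> B" "\<And>k. norm (orbit_deriv k z w) \<le> C"
    by (auto simp: stable_dir_def)
  then have "norm (orbit_deriv k z (v + w)) \<le> B + C" for k
    unfolding linear_add[OF linear_orbit_deriv] by (metis norm_triangle_mono)
  then show "v + w \<in> stable_dir z" by (auto simp: stable_dir_def)
next
  fix c :: real and v assume "v \<in> stable_dir z"
  then obtain B where "\<And>k. norm (orbit_deriv k z v) \<le> B"
    by (auto simp: stable_dir_def)
  then have "norm (orbit_deriv k z (c *\<^sub>R v)) \<le> \<bar>c\<bar> * B" for k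
    unfolding linear_scale[OF linear_orbit_deriv] by (simp add: mult_left_mono)
  then show "c *\<^sub>R v \<in> stable_dir z" by (auto simp: stable_dir_def)
qed

lemma pseudo_orbit_deriv:
  assumes "z \<in> V"
  shows "pseudo_orbit (\<lambda>k. orbit_deriv k z v)"
  using norm_D\<eta>_le[OF V_orbit_ball[OF assms]] by (simp add: pseudo_orbit_def)

lemma stable_dir_iff_cone:
  assumes "z \<in> V"
  shows "v \<in> stable_dir z \<longleftrightarrow>
    (\<forall>k. norm (Q (orbit_deriv k z v)) \<le> norm (P (orbit_deriv k z v)))" (is "_ \<longleftrightarrow> ?cone")
proof
  assume "v \<in> stable_dir z"
  then obtain C where "\<And>k. norm (orbit_deriv k z v) \<le> C" by (auto simp: stable_dir_def)
  with bounded_pseudo_orbit_cone[OF pseudo_orbit_deriv[OF assms, of v]] show ?cone by blast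
next
  assume ?cone
  then show "v \<in> stable_dir z"
    using cone_pseudo_orbit_bound[OF pseudo_orbit_deriv[OF assms, of v]]
    by (auto simp: stable_dir_def)
qed

lemma stable_dir_cone:
  assumes "z \<in> V" "v \<in> stable_dir z"
  shows "norm (Q v) \<le> norm (P v)"
  using stable_dir_iff_cone[OF assms(1), of v] assms(2) by (auto dest: spec[of _ 0])

lemma stable_dir_unique:
  assumes "z \<in> V" "v \<in> stable_dir z" "w \<in> stable_dir z" "P v = P w"
  shows "v = w"
proof -
  have "v - w \<in> stable_dir z" using assms by (intro subspace_diff subspace_stable_dir)
  from stable_dir_cone[OF assms(1) this] assms(4)
  have "Q (v - w) = 0" "P (v - w) = 0" by (simp_all add: coord_proj_linear_simps)
  then show ?thesis using coord_proj_add_compl[of S "v - w"] by simp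
qed

lemma stable_dir_closed:
  assumes "s \<longlonglongrightarrow> z" "\<And>n. s n \<in> V" "z \<in> V" "w \<longlonglongrightarrow> v" "\<And>n. w n \<in> stable_dir (s n)"
  shows "v \<in> stable_dir z"
  unfolding stable_dir_iff_cone[OF assms(3)]
proof
  fix k
  show "norm (Q (orbit_deriv k z v)) \<le> norm (P (orbit_deriv k z v))"
    by (rule LIMSEQ_le[OF tendsto_norm[OF tendsto_coord_proj[OF tendsto_orbit_deriv]]
          tendsto_norm[OF tendsto_coord_proj[OF tendsto_orbit_deriv]]])
      (use assms stable_dir_iff_cone in blast)+
qed

text \<open>Secants of \<open>V\<close> respect the cone at all times by \<open>V_diff_cone\<close>,
  and their images under the orbit maps converge to the linearised orbit of
  \<open>v\<close>.\<close>

lemma secant_limit_stable_dir: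
  assumes z: "z \<in> V" and s: "\<And>n. s n \<in> V" and t: "t \<longlonglongrightarrow> 0" "\<And>n. t n > 0"
    and v: "(\<lambda>n. (1 / t n) *\<^sub>R (s n - z)) \<longlonglongrightarrow> v"
  shows "v \<in> stable_dir z"
  unfolding stable_dir_iff_cone[OF z]
proof
  fix k
  have lim: "(\<lambda>n. (1 / t n) *\<^sub>R (orbit g k (s n) - orbit g k z)) \<longlonglongrightarrow> orbit_deriv k z v"
    by (rule has_derivative_sequentially[OF orbit_has_derivative t v])
  have "norm (Q ((1 / t n) *\<^sub>R (orbit g k (s n) - orbit g k z)))
      \<le> norm (P ((1 / t n) *\<^sub>R (orbit g k (s n) - orbit g k z)))" for n
    unfolding linear_scale[OF linear_coord_proj] norm_scaleR
    by (intro mult_left_mono V_diff_cone s z) auto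
  then show "norm (Q (orbit_deriv k z v)) \<le> norm (P (orbit_deriv k z v))"
    by (intro LIMSEQ_le[OF tendsto_norm[OF tendsto_coord_proj[OF lim]]
          tendsto_norm[OF tendsto_coord_proj[OF lim]]]) blast
qed

section \<open>The stable set as a graph\<close>

text \<open>The inverse of \<open>P\<close> on \<open>V\<close>, unique by \<open>V_unique\<close>.
  Accepting any \<open>x\<close> and using only \<open>P x\<close> gives it an open domain in the
  ambient space.\<close>

definition lift :: "real^'n \<Rightarrow> real^'n"
  where "lift x = (SOME z. z \<in> V \<and> P z = P x)"

lemma lift_V: "norm (P x) < R / 2 \<Longrightarrow> lift x \<in> V"
  and P_lift: "norm (P x) < R / 2 \<Longrightarrow> P (lift x) = P x"
  using someI_ex[of "\<lambda>z. z \<in> V \<and> P z = P x"] V_exists[of x] unfolding lift_def by blast+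

lemma V_unique:
  assumes "x \<in> V" "y \<in> V" "P x = P y"
  shows "x = y"
proof -
  have "norm (Q (x - y)) \<le> norm (P (x - y))"
    using V_diff_cone[OF assms(1,2), of 0] by simp
  with assms(3) have "Q (x - y) = 0" "P (x - y) = 0" by (simp_all add: coord_proj_linear_simps)
  then show ?thesis using coord_proj_add_compl[of S "x - y"] by simp
qed

lemma norm_V_diff:
  assumes "x \<in> V" "y \<in> V"
  shows "norm (x - y) \<le> 2 * norm (P x - P y)"
  using V_diff_cone[OF assms, of 0] norm_le_coord_proj[of "x - y" S]
  by (simp add: coord_proj_linear_simps)

lemma V_iff_lift: "x \<in> V \<longleftrightarrow> norm (P x) < R / 2 \<and> lift x = x"
  using lift_V P_lift V_unique by (metis (no_types, lifting) V_def mem_Collect_eq)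

lemma lift_diff:
  assumes "norm (P x) < R / 2" "norm (P y) < R / 2"
  shows "norm (lift x - lift y) \<le> 2 * norm (P (x - y))"
  using norm_V_diff[OF lift_V[OF assms(1)] lift_V[OF assms(2)]] P_lift assms
  by (simp add: coord_proj_linear_simps)

lemma open_domain: "open {x. norm (P x) < R / 2}"
proof -
  have "open (P -` ball 0 (R / 2))"
    by (rule open_vimage[OF open_ball continuous_on_coord_proj])
  moreover have "P -` ball 0 (R / 2) = {x. norm (P x) < R / 2}" by auto
  ultimately show ?thesis by simp
qed

text \<open>The secants from \<open>z\<close> to the points of \<open>V\<close> above
  \<open>z + t n *\<^sub>R w\<close> have bounded quotients with stable part \<open>P w\<close>; a
  subsequential limit is the required vector.\<close>

lemma stable_dir_exists:
  assumes z: "z \<in> V"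
  shows "\<exists>v\<in>stable_dir z. P v = P w"
proof -
  let ?h = "\<lambda>n. inverse (real (Suc n)) *\<^sub>R w"
  have "(\<lambda>n. z + ?h n) \<longlonglongrightarrow> z + 0 *\<^sub>R w"
    by (intro tendsto_add tendsto_const tendsto_scaleR LIMSEQ_inverse_real_of_nat)
  then have "(\<lambda>n. z + ?h n) \<longlonglongrightarrow> z" by simp
  moreover have "z \<in> {x. norm (P x) < R / 2}" using z by (simp add: V_def)
  ultimately have "\<forall>\<^sub>F n in sequentially. z + ?h n \<in> {x. norm (P x) < R / 2}"
    using open_domain by (blast dest: topological_tendstoD)
  then obtain N where N: "\<And>n. n \<ge> N \<Longrightarrow> norm (P (z + ?h n)) < R / 2"
    by (auto simp: eventually_sequentially)
  define t where "t n = inverse (real (Suc (n + N)))" for n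
  define s where "s n = lift (z + t n *\<^sub>R w)" for n
  have t: "t n > 0" for n by (simp add: t_def)
  have t0: "t \<longlonglongrightarrow> 0"
    unfolding t_def by (rule LIMSEQ_ignore_initial_segment[OF LIMSEQ_inverse_real_of_nat])
  have dom: "norm (P (z + t n *\<^sub>R w)) < R / 2" for n using N[of "n + N"] by (simp add: t_def)
  have s: "s n \<in> V" "P (s n) = P z + t n *\<^sub>R P w" for n
    using lift_V[OF dom[of n]] P_lift[OF dom[of n]] by (auto simp: s_def coord_proj_linear_simps)
  let ?q = "\<lambda>n. (1 / t n) *\<^sub>R (s n - z)"
  have "norm (?q n) \<le> 2 * norm (P w)" for n
  proof -
    have "norm (s n - z) \<le> t n * (2 * norm (P w))"
      using norm_V_diff[OF s(1)[of n] z] s(2)[of n] t[of n] by simp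
    then show ?thesis unfolding norm_scaleR using t[of n] by (simp add: field_simps)
  qed
  then have "bounded (range ?q)" by (auto simp: bounded_iff)
  then obtain v r where r: "strict_mono r" "(?q \<circ> r) \<longlonglongrightarrow> v"
    using bounded_imp_convergent_subsequence by blast
  have "v \<in> stable_dir z"
    using r(2) LIMSEQ_subseq_LIMSEQ[OF t0 r(1)] t s(1)
    by (intro secant_limit_stable_dir[OF z, of "s \<circ> r" "t \<circ> r"]) (auto simp: o_def)
  moreover have "P (?q n) = P w" for n
    using t[of n] by (simp add: coord_proj_linear_simps s(2))
  then have "P v = P w"
    using tendsto_coord_proj[OF r(2), of S] by (simp add: o_def LIMSEQ_const_iff)
  ultimately show ?thesis by blast
qed

section \<open>Continuous differentiability of the graph\<close>

text \<open>The linear counterpart of \<open>lift\<close>, with \<open>stable_dir z\<close> in place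
  of \<open>V\<close>; it turns out to be the derivative of \<open>lift\<close>.\<close>

definition tangent_lift :: "real^'n \<Rightarrow> real^'n \<Rightarrow> real^'n"
  where "tangent_lift z w = (SOME v. v \<in> stable_dir z \<and> P v = P w)"

lemma tangent_lift_stable: "z \<in> V \<Longrightarrow> tangent_lift z w \<in> stable_dir z"
  and P_tangent_lift: "z \<in> V \<Longrightarrow> P (tangent_lift z w) = P w"
  using someI_ex[of "\<lambda>v. v \<in> stable_dir z \<and> P v = P w"] stable_dir_exists[of z w]
  unfolding tangent_lift_def by blast+

lemma tangent_lift_eqI:
  "z \<in> V \<Longrightarrow> v \<in> stable_dir z \<Longrightarrow> P v = P w \<Longrightarrow> tangent_lift z w = v"
  by (rule stable_dir_unique) (simp_all add: tangent_lift_stable P_tangent_lift)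

lemma norm_tangent_lift:
  assumes "z \<in> V"
  shows "norm (tangent_lift z w) \<le> 2 * norm w"
  using stable_dir_cone[OF assms tangent_lift_stable[OF assms], of w] P_tangent_lift[OF assms, of w]
    norm_le_coord_proj[of "tangent_lift z w" S] norm_coord_proj_le[of S w] by simp

lemma bounded_linear_tangent_lift:
  assumes z: "z \<in> V"
  shows "bounded_linear (tangent_lift z)"
proof (rule bounded_linear_intro)
  show "norm (tangent_lift z w) \<le> norm w * 2" for w using norm_tangent_lift[OF z, of w] by simp
  show "tangent_lift z (v + w) = tangent_lift z v + tangent_lift z w" for v w
    by (rule tangent_lift_eqI[OF z])
      (use z in \<open>auto intro!: subspace_add subspace_stable_dir tangent_lift_stable
        simp: coord_proj_linear_simps P_tangent_lift\<close>)
  show "tangent_lift z (c *\<^sub>R w) = c *\<^sub>R tangent_lift z w" for c w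
    by (rule tangent_lift_eqI[OF z])
      (use z in \<open>auto intro!: subspace_scale subspace_stable_dir tangent_lift_stable
        simp: coord_proj_linear_simps P_tangent_lift\<close>)
qed

text \<open>Otherwise some difference quotients stay at distance \<open>e\<close> from their images
  under \<open>?T\<close>. They are bounded, and a subsequential limit is a stable direction, which
  \<open>?T\<close> fixes: a contradiction.\<close>

lemma lift_has_derivative:
  assumes x: "norm (P x) < R / 2"
  shows "(lift has_derivative tangent_lift (lift x)) (at x)"
proof -
  let ?z = "lift x" and ?T = "tangent_lift (lift x)"
  have z: "?z \<in> V" by (rule lift_V[OF x])
  interpret T: bounded_linear ?T by (rule bounded_linear_tangent_lift[OF z])
  have "\<exists>d>0. \<forall>y. norm (y - x) < d \<longrightarrow> norm (lift y - lift x - ?T (y - x)) \<le> e * norm (y - x)"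
    if e: "e > 0" for e
  proof (rule ccontr)
    assume neg: "\<not> ?thesis"
    have "\<exists>y. norm (y - x) < inverse (real (Suc n)) \<and> norm (P y) < R / 2 \<and>
        e * norm (y - x) < norm (lift y - lift x - ?T (y - x))" for n
    proof -
      obtain r where r: "r > 0" "ball x r \<subseteq> {x. norm (P x) < R / 2}"
        using open_domain x by (metis mem_Collect_eq openE)
      have "min r (inverse (real (Suc n))) > 0" using r by simp
      with neg obtain y where y: "norm (y - x) < min r (inverse (real (Suc n)))"
        "\<not> norm (lift y - lift x - ?T (y - x)) \<le> e * norm (y - x)" by meson
      then have "y \<in> ball x r" by (simp add: dist_norm norm_minus_commute)
      with r(2) y show ?thesis by (intro exI[of _ y]) auto
    qed
    then obtain y where y: "\<And>n. norm (y n - x) < inverse (real (Suc n))"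
      "\<And>n. norm (P (y n)) < R / 2" "\<And>n. e * norm (y n - x) < norm (lift (y n) - lift x - ?T (y n - x))"
      by metis
    define t where "t n = norm (y n - x)" for n
    \<comment> \<open>Strictness in the choice of \<open>y n\<close> excludes
      \<open>y n = x\<close>, where both sides vanish.\<close>
    have t: "t n > 0" for n
      using y(3)[of n] by (cases "y n = x") (auto simp: t_def)
    have t0: "t \<longlonglongrightarrow> 0"
      by (rule Lim_null_comparison[OF always_eventually LIMSEQ_inverse_real_of_nat])
        (use y(1) in \<open>simp add: t_def less_imp_le\<close>)
    let ?q = "\<lambda>n. (1 / t n) *\<^sub>R (lift (y n) - ?z)"
    have "norm (?q n) \<le> 2" for n
    proof -
      have "norm (lift (y n) - ?z) \<le> 2 * t n"
        using lift_diff[OF y(2)[of n] x] norm_coord_proj_le[of S "y n - x"] by (simp add: t_def)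
      then show ?thesis unfolding norm_scaleR using t[of n] by (simp add: field_simps)
    qed
    then have "bounded (range ?q)" by (auto simp: bounded_iff)
    then obtain v r where r: "strict_mono r" "(?q \<circ> r) \<longlonglongrightarrow> v"
      using bounded_imp_convergent_subsequence by blast
    have "v \<in> stable_dir ?z"
      using r(2) LIMSEQ_subseq_LIMSEQ[OF t0 r(1)] t lift_V[OF y(2)]
      by (intro secant_limit_stable_dir[OF z, of "lift \<circ> y \<circ> r" "t \<circ> r"]) (auto simp: o_def)
    then have v: "?T v = v" by (intro tangent_lift_eqI z refl)
    \<comment> \<open>\<open>?T\<close> depends only on the stable part, and
      \<open>lift (y n) - ?z\<close> has the same stable part as \<open>y n - x\<close>.\<close>
    have Tq: "?T (?q n) = (1 / t n) *\<^sub>R ?T (y n - x)" for n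
      by (rule tangent_lift_eqI[OF z])
        (use z in \<open>auto intro!: subspace_scale subspace_stable_dir tangent_lift_stable
          simp: linear_scale[OF linear_coord_proj] linear_diff[OF linear_coord_proj]
            P_tangent_lift P_lift[OF y(2)] P_lift[OF x]\<close>)
    have big: "e \<le> norm (?q n - ?T (?q n))" for n
    proof -
      have eq: "?q n - ?T (?q n) = (1 / t n) *\<^sub>R (lift (y n) - lift x - ?T (y n - x))"
        unfolding Tq by (simp add: scaleR_diff_right)
      have "e * t n \<le> norm (lift (y n) - lift x - ?T (y n - x))"
        using y(3)[of n] by (simp add: t_def)
      then show ?thesis unfolding eq norm_scaleR using t[of n] by (simp add: pos_le_divide_eq)
    qed
    have "(\<lambda>n. norm (?q (r n) - ?T (?q (r n)))) \<longlonglongrightarrow> norm (v - ?T v)"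
      using r(2) unfolding o_def by (intro tendsto_norm tendsto_diff T.tendsto)
    then have "e \<le> norm (v - ?T v)" using big by (intro LIMSEQ_le_const) auto
    with v e show False by simp
  qed
  then show ?thesis unfolding has_derivative_at_alt using T.bounded_linear_axioms by blast
qed

text \<open>A sequence staying away from the claimed limit would have a cluster point; this is a
  stable direction at \<open>z\<close> over \<open>P w\<close>, hence equal to that limit by
  uniqueness.\<close>

lemma tendsto_tangent_lift:
  assumes s: "s \<longlonglongrightarrow> z" "\<And>n. s n \<in> V" and z: "z \<in> V"
  shows "(\<lambda>n. tangent_lift (s n) w) \<longlonglongrightarrow> tangent_lift z w"
proof (rule ccontr)
  assume "\<not> ?thesis"
  then obtain e where e: "e > 0"
    "\<not> (\<forall>\<^sub>F n in sequentially. dist (tangent_lift (s n) w) (tangent_lift z w) < e)"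
    by (auto simp: tendsto_iff)
  then obtain r :: "nat \<Rightarrow> nat" where r: "strict_mono r"
    "\<And>n. \<not> dist (tangent_lift (s (r n)) w) (tangent_lift z w) < e"
    using not_eventually_sequentiallyD[OF e(2)] by blast
  let ?q = "\<lambda>n. tangent_lift (s (r n)) w"
  have "bounded (range ?q)"
    using norm_tangent_lift[OF s(2), of _ w] by (auto simp: bounded_iff)
  then obtain v r' where r': "strict_mono r'" "(?q \<circ> r') \<longlonglongrightarrow> v"
    using bounded_imp_convergent_subsequence by blast
  have "v \<in> stable_dir z"
  proof (rule stable_dir_closed[OF _ _ z r'(2)])
    show "(s \<circ> (r \<circ> r')) \<longlonglongrightarrow> z"
      by (rule LIMSEQ_subseq_LIMSEQ[OF s(1) strict_mono_o[OF r(1) r'(1)]])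
  qed (simp_all add: s(2) tangent_lift_stable)
  moreover have "P v = P w"
    using tendsto_coord_proj[OF r'(2), of S] by (simp add: o_def P_tangent_lift s(2) LIMSEQ_const_iff)
  ultimately have "tangent_lift z w = v" by (intro tangent_lift_eqI z)
  then have "(\<lambda>n. dist (?q (r' n)) (tangent_lift z w)) \<longlonglongrightarrow> 0"
    using tendsto_dist_iff[THEN iffD1, OF r'(2)] by (simp only: o_def)
  moreover have "e \<le> dist (?q (r' n)) (tangent_lift z w)" for n
    using r(2)[of "r' n"] by simp
  ultimately have "e \<le> 0" by (intro LIMSEQ_le_const) auto
  with e(1) show False by simp
qed

lemma continuous_on_tangent_lift:
  "continuous_on {x. norm (P x) < R / 2} (\<lambda>x. tangent_lift (lift x) w)"
proof (rule continuous_on_sequentiallyI)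
  fix u a assume u: "\<forall>n. u n \<in> {x. norm (P x) < R / 2}" and a: "a \<in> {x. norm (P x) < R / 2}"
    and lim: "u \<longlonglongrightarrow> a"
  have "(\<lambda>n. lift (u n)) \<longlonglongrightarrow> lift a"
    using has_derivative_continuous[OF lift_has_derivative, of a] a lim
    by (auto intro: isCont_tendsto_compose)
  then show "(\<lambda>n. tangent_lift (lift (u n)) w) \<longlonglongrightarrow> tangent_lift (lift a) w"
    by (rule tendsto_tangent_lift) (use u a lift_V in auto)
qed

lemma C1_lift: "C1_on lift {x. norm (P x) < R / 2}"
proof -
  let ?W = "{x. norm (P x) < R / 2}"
  let ?f' = "\<lambda>x. Blinfun (tangent_lift (lift x))"
  have app: "blinfun_apply (?f' x) = tangent_lift (lift x)" if "x \<in> ?W" for x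
    using that by (intro bounded_linear_Blinfun_apply bounded_linear_tangent_lift lift_V) simp
  \<comment> \<open>In finite dimension, continuity on each fixed vector gives continuity in
    operator norm.\<close>
  have "continuous_on ?W (\<lambda>x. blinfun_apply (?f' x) i)" for i
    by (rule continuous_on_eq[OF continuous_on_tangent_lift]) (simp add: app)
  then have "continuous_on ?W ?f'" by (rule continuous_on_blinfun_componentwise)
  then show ?thesis unfolding C1_on_def
    by (intro exI[of _ ?f']) (use app lift_has_derivative in auto)
qed

section \<open>Submanifold structure and tangent space at the origin\<close>

lemma lift_cong: "P x = P y \<Longrightarrow> lift x = lift y"
  by (simp add: lift_def)

text \<open>The shear subtracting \<open>Q (lift x)\<close> flattens \<open>V\<close>. It preserves
  \<open>P x\<close>, and \<open>lift\<close> depends on \<open>P x\<close> alone, so adding the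
  same term inverts it.\<close>

lemma V_submanifold: "C1_submanifold (dim {x. Q x = 0}) V"
  unfolding C1_submanifold_def
proof
  fix p assume p: "p \<in> V"
  let ?W = "{x. norm (P x) < R / 2}"
  let ?\<Phi> = "\<lambda>x. x + (- Q (lift x))" and ?\<Psi> = "\<lambda>x. x + Q (lift x)"
  have lin: "bounded_linear (\<lambda>x. - Q x)"
    by (intro bounded_linear_minus bounded_linear_coord_proj)
  have C1: "C1_on ?\<Phi> ?W" "C1_on ?\<Psi> ?W"
    by (rule C1_on_add[OF C1_on_linear[OF bounded_linear_ident]
        C1_on_compose[OF C1_lift C1_on_linear[OF lin, of UNIV]]] subset_UNIV
      C1_on_add[OF C1_on_linear[OF bounded_linear_ident]
        C1_on_compose[OF C1_lift C1_on_linear[OF bounded_linear_coord_proj[of "- S"], of UNIV]]])+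
  have P: "P (?\<Phi> x) = P x" "P (?\<Psi> x) = P x" for x
    by (simp_all add: coord_proj_linear_simps)
  have lift_eq: "lift (?\<Phi> x) = lift x" "lift (?\<Psi> x) = lift x" for x
    by (rule lift_cong[OF P(1)], rule lift_cong[OF P(2)])
  have inv: "?\<Psi> (?\<Phi> x) = x" "?\<Phi> (?\<Psi> x) = x" for x
    by (simp_all only: lift_eq) simp_all
  have maps: "?\<Phi> x \<in> ?W" "?\<Psi> x \<in> ?W" if "x \<in> ?W" for x using that P by simp_all
  have hom: "homeomorphism ?W ?W ?\<Phi> ?\<Psi>"
    by (rule homeomorphismI) (use C1 C1_on_imp_continuous_on maps inv in blast)+
  have img: "?\<Phi> ` (?W \<inter> V) = ?W \<inter> {x. Q x = 0}"
  proof (intro equalityI subsetI)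
    fix y assume "y \<in> ?\<Phi> ` (?W \<inter> V)"
    then obtain x where x: "x \<in> V" "y = ?\<Phi> x" "y \<in> ?W" using maps(1) by blast
    then have "lift x = x" using V_iff_lift by blast
    with x show "y \<in> ?W \<inter> {x. Q x = 0}" by (simp add: coord_proj_linear_simps)
  next
    fix y assume y: "y \<in> ?W \<inter> {x. Q x = 0}"
    have "?\<Psi> y = P y + Q (lift y)" using y coord_proj_add_compl[of S y] by simp
    also have "\<dots> = lift y" using y P_lift[of y] coord_proj_add_compl[of S "lift y"] by simp
    finally have "?\<Psi> y \<in> V" using y lift_V by simp
    moreover have "?\<Psi> y \<in> ?W" using maps(2) y by blast
    ultimately show "y \<in> ?\<Phi> ` (?W \<inter> V)"
      by (metis (no_types, lifting) IntI image_eqI inv(2))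
  qed
  have pW: "p \<in> ?W" using p by (simp add: V_def)
  have sub: "subspace {x. Q x = 0}" by (rule linear_subspace_kernel[OF linear_coord_proj])
  show "\<exists>(W::(real^'n) set) (W'::(real^'n) set) \<Phi> \<Psi> L. open W \<and> p \<in> W \<and> open W' \<and> homeomorphism W W' \<Phi> \<Psi> \<and>
      C1_on \<Phi> W \<and> C1_on \<Psi> W' \<and> subspace L \<and> dim L = dim {x. Q x = 0} \<and> \<Phi> ` (W \<inter> V) = W' \<inter> L"
    by (rule exI[of _ ?W], rule exI[of _ ?W], rule exI[of _ ?\<Phi>], rule exI[of _ ?\<Psi>],
        rule exI[of _ "{x. Q x = 0}"], intro conjI open_domain pW hom C1 sub refl img)
qed

lemma lift_zero: "lift 0 = 0"
  using zero_in_V V_iff_lift by blast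

text \<open>The derivative of the perturbation vanishes at the origin, so the linearised system
  there is diagonal and a vector without unstable part never acquires one.\<close>

lemma tangent_lift_zero: "tangent_lift 0 w = P w"
proof (rule tangent_lift_eqI[OF zero_in_V])
  have "Q (orbit_deriv k 0 (P w)) = 0" for k
    by (induction k)
      (simp_all add: orbit_zero D\<eta>_zero proj_A linear_0[OF linear_A])
  then show "P w \<in> stable_dir 0" by (simp add: stable_dir_iff_cone[OF zero_in_V])
qed simp

lemma lift_has_derivative_zero: "(lift has_derivative P) (at 0)"
  using lift_has_derivative[of 0] R_pos
  by (simp add: coord_proj_linear_simps lift_zero tangent_lift_zero[abs_def])

text \<open>A curve in \<open>V\<close> is fixed by \<open>lift\<close>, whose derivative at 0 is
  \<open>P\<close>, so its velocity is fixed by \<open>P\<close>. Conversely, \<open>lift\<close>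
  bends the line through a stable vector into a curve in \<open>V\<close> with that
  velocity.\<close>

lemma V_tangent_space: "tangent_space V 0 = {x. Q x = 0}"
proof (intro equalityI subsetI)
  fix v assume "v \<in> tangent_space V 0"
  then obtain \<gamma> :: "real \<Rightarrow> real^'n" and e where e: "e > 0" "\<gamma> ` {-e<..<e} \<subseteq> V" "\<gamma> 0 = 0"
    and v: "(\<gamma> has_vector_derivative v) (at 0)"
    unfolding tangent_space_def by blast
  have "(\<gamma> has_derivative (\<lambda>h. h *\<^sub>R v)) (at 0)" using v by (simp add: has_vector_derivative_def)
  moreover have "(lift has_derivative P) (at (\<gamma> 0))" using e lift_has_derivative_zero by simp
  ultimately have "((\<lambda>t. lift (\<gamma> t)) has_derivative (\<lambda>h. P (h *\<^sub>R v))) (at 0)"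
    by (rule has_derivative_compose)
  then have "(\<gamma> has_derivative (\<lambda>h. P (h *\<^sub>R v))) (at 0)"
  proof (rule has_derivative_transform_within_open)
    show "open {-e<..<e}" "0 \<in> {-e<..<e}" using e by auto
    show "lift (\<gamma> t) = \<gamma> t" if "t \<in> {-e<..<e}" for t using that e V_iff_lift by blast
  qed
  then have "(\<gamma> has_vector_derivative P v) (at 0)"
    by (simp add: has_vector_derivative_def linear_scale[OF linear_coord_proj])
  with v have "v = P v" by (rule vector_derivative_unique_at)
  then have "Q v = Q (P v)" by (rule arg_cong)
  then show "v \<in> {x. Q x = 0}" by simp
next
  fix v assume "v \<in> {x. Q x = 0}"
  then have Pv: "P v = v" using coord_proj_add_compl[of S v] by simp
  \<comment> \<open>Small enough to keep the segment in the domain of \<open>lift\<close>; the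
    \<open>+ 1\<close> covers \<open>v = 0\<close>.\<close>
  define e where "e = R / (2 * (norm v + 1))"
  have e: "e > 0" using R_pos by (simp add: e_def add_nonneg_pos)
  have dom: "norm (P (t *\<^sub>R v)) < R / 2" if "t \<in> {-e<..<e}" for t
  proof -
    have "norm (P (t *\<^sub>R v)) = \<bar>t\<bar> * norm v" by (simp add: linear_scale[OF linear_coord_proj] Pv)
    also have "\<dots> \<le> \<bar>t\<bar> * (norm v + 1)" by (intro mult_left_mono) auto
    also have "\<dots> < e * (norm v + 1)" using that by (intro mult_strict_right_mono) (auto intro: add_nonneg_pos)
    also have "\<dots> = R / 2" by (simp add: e_def field_simps add_nonneg_eq_0_iff)
    finally show ?thesis .
  qed
  let ?\<gamma> = "\<lambda>t. lift (t *\<^sub>R v)"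
  have deriv: "(?\<gamma> has_vector_derivative tangent_lift (lift (t *\<^sub>R v)) v) (at t)"
    if "t \<in> {-e<..<e}" for t
  proof -
    have "((\<lambda>t. t *\<^sub>R v) has_derivative (\<lambda>h. h *\<^sub>R v)) (at t)"
      by (intro bounded_linear_imp_has_derivative bounded_linear_scaleR_left)
    from has_derivative_compose[OF this lift_has_derivative[OF dom[OF that]]]
    show ?thesis
      unfolding has_vector_derivative_def
      by (simp only: linear_scale[OF bounded_linear.linear[OF
            bounded_linear_tangent_lift[OF lift_V[OF dom[OF that]]]]])
  qed
  have cont: "continuous_on {-e<..<e} (\<lambda>t. tangent_lift (lift (t *\<^sub>R v)) v)"
  proof (rule continuous_on_compose2[OF continuous_on_tangent_lift[of v]])
    show "continuous_on {-e<..<e} (\<lambda>t. t *\<^sub>R v)" by (intro continuous_intros)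
    show "(\<lambda>t. t *\<^sub>R v) ` {-e<..<e} \<subseteq> {x. norm (P x) < R / 2}"
      using dom by (intro image_subsetI CollectI)
  qed
  have C1: "?\<gamma> C1_differentiable_on {-e<..<e}"
    unfolding C1_differentiable_on_def
    by (rule exI[of _ "\<lambda>t. tangent_lift (lift (t *\<^sub>R v)) v"], intro conjI ballI deriv cont)
  have img: "?\<gamma> ` {-e<..<e} \<subseteq> V" using lift_V[OF dom] by (intro image_subsetI)
  have zero: "?\<gamma> 0 = 0" by (simp add: lift_zero)
  have "(?\<gamma> has_vector_derivative v) (at 0)"
    using deriv[of 0] e by (simp add: lift_zero tangent_lift_zero Pv)
  with e C1 img zero show "v \<in> tangent_space V 0"
    unfolding tangent_space_def by (intro CollectI exI[of _ ?\<gamma>] exI[of _ e] conjI)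
qed

end

section \<open>Reduction by rescaling the stable coordinates\<close>

text \<open>An eigenvector for a positive eigenvalue vanishes wherever the diagonal entry is not
  positive, and the axis vectors of the other coordinates are such eigenvectors.\<close>

lemma stable_space_diag_matrix:
  fixes l :: "'n::finite \<Rightarrow> real"
  assumes l: "\<And>i. l i \<noteq> 0"
  shows "stable_space (diag_matrix l :: real^'n^'n) = {x. coord_proj (- {i. l i > 0}) x = 0}"
    (is "?E = ?K")
proof
  have "subspace ?K" by (rule linear_subspace_kernel[OF linear_coord_proj])
  moreover have "{v. \<exists>\<mu>>0. eigenvector (diag_matrix l :: real^'n^'n) v \<mu>} \<subseteq> ?K"
    by (auto simp: eigenvector_def diag_matrix_mult_vec vec_eq_iff coord_proj_def)
  ultimately show "?E \<subseteq> ?K" unfolding stable_space_def by (intro span_minimal)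
  show "?K \<subseteq> ?E"
  proof
    fix x :: "real^'n" assume x: "x \<in> ?K"
    have "(x $ i) *\<^sub>R axis i 1 \<in> ?E" for i
    proof (cases "l i > 0")
      case True
      have "eigenvector (diag_matrix l) (axis i 1 :: real^'n) (l i)"
        by (auto simp: eigenvector_def diag_matrix_mult_vec vec_eq_iff axis_def)
      with True show ?thesis unfolding stable_space_def by (intro span_scale span_base) auto
    next
      case False
      with x have "x $ i = 0" by (auto simp: coord_proj_def vec_eq_iff split: if_splits dest: spec[of _ i])
      then show ?thesis by (simp add: stable_space_def span_zero)
    qed
    then have "(\<Sum>i\<in>UNIV. x $ i *\<^sub>R axis i 1) \<in> ?E" unfolding stable_space_def by (intro span_sum)
    then show "x \<in> ?E" using basis_expansion[of x] by (simp add: scalar_mult_eq_scaleR)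
  qed
qed

definition coord_scale :: "'n set \<Rightarrow> real \<Rightarrow> real^'n \<Rightarrow> real^'n"
  where "coord_scale S r x = (\<chi> i. if i \<in> S then r * x $ i else x $ i)"

lemma linear_coord_scale: "linear (coord_scale S r)"
  by (rule linearI) (auto simp: coord_scale_def vec_eq_iff algebra_simps)

lemma bounded_linear_coord_scale: "bounded_linear (coord_scale S r :: real^'n \<Rightarrow> real^'n)"
  by (simp add: linear_coord_scale linear_conv_bounded_linear[symmetric])

lemma coord_scale_coord_scale: "coord_scale S r (coord_scale S s x) = coord_scale S (r * s) x"
  by (auto simp: coord_scale_def vec_eq_iff)

lemma coord_scale_one: "coord_scale S 1 x = x"
  by (auto simp: coord_scale_def vec_eq_iff)

lemma norm_coord_scale_le:
  assumes "\<bar>r\<bar> \<le> B" "1 \<le> B"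
  shows "norm (coord_scale S r x) \<le> B * norm x"
proof -
  have "norm (coord_scale S r x) \<le> norm (B *\<^sub>R x)"
    by (rule norm_le_componentwise_cart)
      (use assms mult_right_mono[of 1 B] in \<open>auto simp: coord_scale_def abs_mult intro!: mult_right_mono\<close>)
  then show ?thesis using assms by simp
qed

theorem theorem4p1:
  fixes l :: "'d::{finite,linorder} \<Rightarrow> real"
    and H :: "real^'d::_^'d::_"
    and \<alpha> :: "nat \<Rightarrow> real"
    and \<eta> :: "nat \<Rightarrow> real^'d::_ \<Rightarrow> real^'d::_"
    and g :: "nat \<Rightarrow> real^'d::_ \<Rightarrow> real^'d::_"
  assumes H: "H = diag_matrix l"
    and inv: "invertible H"
    and neg: "\<exists>\<mu><0. eigenvalue H \<mu>"
    and ordered: "antimono l"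
    and last_neg: "l (Max UNIV) < 0"
    and \<alpha>_pos: "\<And>k. \<alpha> k > 0"
    and \<alpha>_order: "\<alpha> \<in> \<Omega>(\<lambda>k. 1 / real k)"
    and \<alpha>_lim: "\<alpha> \<longlonglongrightarrow> 0"
    and \<eta>_C1: "\<And>k. C1_on (\<eta> k) UNIV"
    and \<eta>_zero: "\<And>k. \<eta> k 0 = 0"
    and \<eta>_lipschitz: "\<And>\<epsilon>. \<epsilon> > 0 \<Longrightarrow>
          \<exists>W. open W \<and> 0 \<in> W \<and>
            (\<forall>k. \<forall>x\<in>W. \<forall>y\<in>W. norm (\<eta> k x - \<eta> k y) \<le> \<alpha> k * \<epsilon> * norm (x - y))"
    and g: "\<And>k x. g k x = (mat 1 - \<alpha> k *\<^sub>R H) *v x + \<eta> k x"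
  shows "\<exists>U V. open U \<and> 0 \<in> U \<and>
           V \<subseteq> U \<and> 0 \<in> V \<and>
           C1_submanifold (dim (stable_space H)) V \<and>
           tangent_space V 0 = stable_space H \<and>
           (\<forall>x. x 0 \<in> V \<and> (\<forall>k. x (Suc k) = g k (x k)) \<longrightarrow> (\<lambda>k. g k (x k)) \<longlonglongrightarrow> 0) \<and>
           U \<inter> (\<Inter>k. iterate_maps g k 0 -` U) \<subseteq> V"
proof -
  define S where "S = {i. l i > 0}"
  have l: "l i \<noteq> 0" for i using inv unfolding H by (rule diag_matrix_invertible_nonzero)
  have g': "g k x = (\<chi> i. (1 - \<alpha> k * l i) * x $ i) + \<eta> k x" for k x
  proof -
    have "(mat 1 - \<alpha> k *\<^sub>R H) *v x = x - \<alpha> k *\<^sub>R (H *v x)"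
      by (simp add: matrix_vector_mult_diff_rdistrib scaleR_matrix_vector_assoc)
    then show ?thesis unfolding g H diag_matrix_mult_vec by (simp add: vec_eq_iff algebra_simps)
  qed

  \<comment> \<open>Constants of the rescaling\<close>
  define m where "m = Min (range (\<lambda>i. \<bar>l i\<bar>))"
  have m: "m > 0" unfolding m_def using l by (subst Min_gr_iff) auto
  have m_le: "m \<le> \<bar>l i\<bar>" for i unfolding m_def by (rule Min_le) auto
  define L where "L = Max (range (\<lambda>i. \<bar>l i\<bar>))"
  have L: "\<bar>l i\<bar> \<le> L" for i unfolding L_def by (rule Max_ge) auto
  have L0: "L > 0" using m m_le[of undefined] L[of undefined] by linarith
  obtain M where M: "M > 0" "\<And>k. \<alpha> k \<le> M"
    using convergent_imp_Bseq[OF convergentI[OF \<alpha>_lim]] unfolding Bseq_def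
    by (auto simp: abs_le_iff)
  have "(\<lambda>k. \<alpha> k * L) \<longlonglongrightarrow> 0" using \<alpha>_lim by (rule tendsto_mult_left_zero)
  then have "\<forall>\<^sub>F k in sequentially. \<alpha> k * L < 1" by (rule order_tendstoD) simp
  \<comment> \<open>From time \<open>K\<close> on the multipliers
    \<open>1 - \<alpha> k * l i\<close> are positive; only earlier steps need rescaling.\<close>
  then obtain K where K: "\<And>k. k \<ge> K \<Longrightarrow> \<alpha> k * L < 1" by (auto simp: eventually_sequentially)

  \<comment> \<open>Twice a bound for all \<open>\<bar>1 - \<alpha> k * l i\<bar>\<close>, so that
    one division by \<open>D\<close> brings a stable multiplier down to at most 1/2.\<close>
  define D where "D = 2 * (1 + M * L)"
  have D: "D \<ge> 2" using M L0 by (simp add: D_def)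
  \<comment> \<open>The accumulated scale: one factor for each step before \<open>K\<close>,
    constant afterwards. It is 1 at time 0, so initial points are unchanged.\<close>
  define c where "c k = (1 / D) ^ min k K" for k
  have c0: "c 0 = 1" by (simp add: c_def)
  have c_pos: "c k > 0" for k using D by (simp add: c_def)
  have c_le: "c k \<le> 1" for k using D by (auto simp: c_def intro!: power_le_one)
  define B where "B = D ^ K"
  have B: "B \<ge> 1" using D by (simp add: B_def)
  have c_inv: "1 / c k \<le> B" for k
    using D by (simp add: c_def B_def power_one_over power_increasing)
  have c_ratio: "c (Suc k) / c k = (if k < K then 1 / D else 1)" for k
    using D by (auto simp: c_def min_def not_less)

  \<comment> \<open>The first bound gives \<open>b k \<le> \<alpha> k * \<bar>l i\<bar>\<close>, the
    second \<open>b k \<le> 1 / 2\<close>.\<close>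
  define \<kappa> where "\<kappa> = min m (1 / (2 * M))"
  have \<kappa>: "\<kappa> > 0" using m M by (simp add: \<kappa>_def)
  define b where "b k = \<alpha> k * \<kappa>" for k
  have b_pos: "b k > 0" for k using \<alpha>_pos \<kappa> by (simp add: b_def)
  have b_half: "b k \<le> 1 / 2" for k
  proof -
    have "\<alpha> k * \<kappa> \<le> M * (1 / (2 * M))"
      using M \<alpha>_pos[of k] \<kappa> by (intro mult_mono) (auto simp: \<kappa>_def)
    then show ?thesis using M by (simp add: b_def)
  qed
  have b_le: "b k \<le> \<alpha> k * \<bar>l i\<bar>" for k i
  proof -
    have "\<kappa> \<le> \<bar>l i\<bar>" using m_le[of i] by (simp add: \<kappa>_def)
    then show ?thesis unfolding b_def using \<alpha>_pos[of k] by (intro mult_left_mono) auto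
  qed
  \<comment> \<open>Undoing the scale costs a factor of at most \<open>B\<close> and applying it
    costs none, so the rescaled perturbation has constant
    \<open>\<alpha> k * \<epsilon> * B = b k / 8\<close>.\<close>
  define \<epsilon> where "\<epsilon> = \<kappa> / (8 * B)"
  have "\<epsilon> > 0" using \<kappa> B by (simp add: \<epsilon>_def)
  from \<eta>_lipschitz[OF this] obtain W where W: "open W" "0 \<in> W"
    "\<And>k x y. x \<in> W \<Longrightarrow> y \<in> W \<Longrightarrow> norm (\<eta> k x - \<eta> k y) \<le> \<alpha> k * \<epsilon> * norm (x - y)"
    by blast
  then obtain r where r: "r > 0" "ball 0 r \<subseteq> W" by (metis openE)
  define R where "R = r / B"
  have R: "R > 0" using r B by (simp add: R_def)

  let ?T = "coord_scale S"
  \<comment> \<open>The system in the coordinates \<open>?T (c k) x\<close> at time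
    \<open>k\<close>: the scale of time \<open>k\<close> is undone before each step and that of time
    \<open>Suc k\<close> applied after it.\<close>
  define a where "a k i = (if i \<in> S then c (Suc k) / c k else 1) * (1 - \<alpha> k * l i)" for k i
  define \<eta>' where "\<eta>' k x = ?T (c (Suc k)) (\<eta> k (?T (1 / c k) x))" for k x
  have T_up: "norm (?T (1 / c k) x) \<le> B * norm x" for k x
    using c_inv[of k] c_pos[of k] B by (intro norm_coord_scale_le) auto
  have T_down: "norm (?T (c k) x) \<le> norm x" for k x
    using norm_coord_scale_le[of "c k" 1 S x] c_le[of k] c_pos[of k] by simp
  have T_inv: "?T (1 / c k) (?T (c k) x) = x" for k x
    using c_pos[of k] by (simp add: coord_scale_coord_scale coord_scale_one)

  \<comment> \<open>Hyperbolicity of the rescaled system\<close>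
  interpret hyperbolic_system S a b \<eta>' R
  proof
    show "b k > 0" "b k \<le> 1 / 2" for k by (rule b_pos b_half)+
    show "R > 0" by (rule R)
    have "filterlim (\<lambda>n. (\<Sum>k<n. \<alpha> k) * \<kappa>) at_top sequentially"
      by (rule filterlim_at_top_mult_tendsto_pos[OF tendsto_const \<kappa> partial_sums_at_top[OF \<alpha>_pos \<alpha>_order]])
    then show "filterlim (\<lambda>n. \<Sum>k<n. b k) at_top sequentially"
      by (simp add: b_def sum_distrib_right)
    show "\<bar>a k i\<bar> \<le> 1 - b k" if "i \<in> S" for k i
    proof (cases "k < K")
      case True
      have "\<alpha> k * \<bar>l i\<bar> \<le> M * L"
        using M L[of i] \<alpha>_pos[of k] by (intro mult_mono) auto
      moreover have "\<bar>1 - \<alpha> k * l i\<bar> \<le> 1 + \<alpha> k * \<bar>l i\<bar>"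
        using \<alpha>_pos[of k] by (metis abs_1 abs_mult abs_of_pos abs_triangle_ineq4)
      ultimately have "2 * \<bar>1 - \<alpha> k * l i\<bar> \<le> D" by (simp add: D_def)
      then have "\<bar>a k i\<bar> \<le> 1 / 2"
        using that True D by (simp add: a_def c_ratio abs_mult field_simps)
      with b_half[of k] show ?thesis by linarith
    next
      case False
      have "\<alpha> k * \<bar>l i\<bar> \<le> \<alpha> k * L" using L[of i] \<alpha>_pos[of k] by (intro mult_left_mono) auto
      with K[of k] False b_le[of k i] that show ?thesis by (auto simp: a_def c_ratio S_def)
    qed
    show "1 + b k \<le> \<bar>a k i\<bar>" if "i \<notin> S" for k i
    proof -
      have "l i < 0" using that l[of i] by (simp add: S_def)
      with b_le[of k i] that show ?thesis by (simp add: a_def)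
    qed
    show "C1_on (\<eta>' k) UNIV" for k
      unfolding \<eta>'_def
      by (rule C1_on_compose[OF C1_on_compose[OF C1_on_linear \<eta>_C1] C1_on_linear])
        (rule bounded_linear_coord_scale subset_UNIV)+
    show \<eta>'0: "\<eta>' k 0 = 0" for k
      by (simp add: \<eta>'_def linear_0[OF linear_coord_scale] \<eta>_zero)
    show "norm (\<eta>' k x - \<eta>' k y) \<le> b k / 8 * norm (x - y)" if xy: "norm x < R" "norm y < R" for k x y
    proof -
      let ?x = "?T (1 / c k) x" and ?y = "?T (1 / c k) y"
      have mem: "?T (1 / c k) z \<in> W" if "norm z < R" for z
      proof -
        have "B * norm z < r" using that B by (simp add: R_def field_simps)
        with T_up[of k z] have "?T (1 / c k) z \<in> ball 0 r" by simp
        with r(2) show ?thesis by blast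
      qed
      have "norm (\<eta>' k x - \<eta>' k y) \<le> norm (\<eta> k ?x - \<eta> k ?y)"
        unfolding \<eta>'_def linear_diff[OF linear_coord_scale, symmetric] by (rule T_down)
      also have "\<dots> \<le> \<alpha> k * \<epsilon> * norm (?x - ?y)" by (intro W(3) mem xy)
      also have "\<dots> \<le> \<alpha> k * \<epsilon> * (B * norm (x - y))"
        unfolding linear_diff[OF linear_coord_scale, symmetric]
        using \<alpha>_pos[of k] \<open>\<epsilon> > 0\<close> by (intro mult_left_mono T_up) auto
      also have "\<dots> = b k / 8 * norm (x - y)" using B by (simp add: \<epsilon>_def b_def)
      finally show ?thesis .
    qed
    show "(\<eta>' k has_derivative (\<lambda>_. 0)) (at 0)" for k
    proof -
      have "(\<eta> k has_derivative (\<lambda>_. 0)) (at 0)"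
      proof (rule has_derivative_zero_if_lipschitz_zero)
        fix e :: real assume "e > 0"
        \<comment> \<open>With \<open>k\<close> fixed, dividing by \<open>\<alpha> k\<close> cancels
          the factor in the Lipschitz hypothesis.\<close>
        then have "e / \<alpha> k > 0" using \<alpha>_pos by simp
        from \<eta>_lipschitz[OF this] \<alpha>_pos[of k] show
          "\<exists>W. open W \<and> 0 \<in> W \<and> (\<forall>x\<in>W. norm (\<eta> k x - \<eta> k 0) \<le> e * norm (x - 0))"
          by (metis less_irrefl nonzero_mult_div_cancel_left times_divide_eq_right)
      qed
      then have "(\<eta> k has_derivative (\<lambda>_. 0)) (at (?T (1 / c k) 0))"
        by (simp add: linear_0[OF linear_coord_scale])
      from has_derivative_compose[OF bounded_linear_imp_has_derivative[OF bounded_linear_coord_scale] this]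
      have "((\<lambda>x. \<eta> k (?T (1 / c k) x)) has_derivative (\<lambda>_. 0)) (at 0)" .
      from has_derivative_compose[OF this
          bounded_linear_imp_has_derivative[OF bounded_linear_coord_scale]]
      show ?thesis unfolding \<eta>'_def by (simp add: linear_0[OF linear_coord_scale])
    qed
  qed

  \<comment> \<open>Transfer to the original system\<close>
  have conj: "hyperbolic_system.g a \<eta>' k (?T (c k) x) = ?T (c (Suc k)) (g k x)" for k x
  proof -
    have "A k (?T (c k) x) = ?T (c (Suc k)) (\<chi> i. (1 - \<alpha> k * l i) * x $ i)"
      using c_pos[of k] by (auto simp: A_def a_def coord_scale_def vec_eq_iff)
    then show ?thesis
      unfolding g_def g' \<eta>'_def T_inv linear_add[OF linear_coord_scale] by simp
  qed
  have orb: "orbit (hyperbolic_system.g a \<eta>') k x = ?T (c k) (orbit g k x)" for k x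
    by (induction k) (simp_all add: c0 coord_scale_one conj)
  \<comment> \<open>Bounding both parts by \<open>R / 2\<close> puts the points of \<open>?U\<close>
    into the ball of radius \<open>R\<close>, while the cone still puts \<open>V\<close> inside
    \<open>?U\<close>.\<close>
  let ?U = "{x. norm (P x) < R / 2} \<inter> {x. norm (Q x) < R / 2}"
  have "open {x. norm (Q x) < R / 2}"
  proof -
    have "open (Q -` ball 0 (R / 2))"
      by (rule open_vimage[OF open_ball continuous_on_coord_proj])
    moreover have "Q -` ball 0 (R / 2) = {x. norm (Q x) < R / 2}" by auto
    ultimately show ?thesis by simp
  qed
  then have U: "open ?U" by (intro open_Int open_domain)
  have VU: "V \<subseteq> ?U"
  proof
    fix x assume "x \<in> V"
    then have "norm (P x) < R / 2" "norm (Q x) \<le> norm (P x)" by (auto simp: V_def dest: spec[of _ 0])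
    then show "x \<in> ?U" by simp
  qed
  have H_stable: "stable_space H = {x. Q x = 0}"
    unfolding H S_def by (rule stable_space_diag_matrix[OF l])
  have conv: "(\<lambda>k. g k (x k)) \<longlonglongrightarrow> 0" if x: "x 0 \<in> V" "\<And>k. x (Suc k) = g k (x k)" for x
  proof -
    have xk: "x k = orbit g k (x 0)" for k by (induction k) (simp_all add: x(2))
    \<comment> \<open>The inverse scales are bounded by \<open>B\<close>, so decay of the rescaled
      orbit gives decay of the original one.\<close>
    have le: "norm (x k) \<le> B * norm (orbit (hyperbolic_system.g a \<eta>') k (x 0))" for k
      using T_up[of k "?T (c k) (x k)"] unfolding T_inv orb xk[symmetric] .
    have "(\<lambda>k. B * norm (orbit (hyperbolic_system.g a \<eta>') k (x 0))) \<longlonglongrightarrow> 0"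
      by (intro tendsto_mult_right_zero tendsto_norm_zero V_orbit_tendsto x)
    then have "x \<longlonglongrightarrow> 0" by (rule Lim_null_comparison[OF always_eventually[OF allI[OF le]]])
    from LIMSEQ_Suc[OF this] show ?thesis by (simp add: x(2))
  qed
  have stay: "?U \<inter> (\<Inter>k. iterate_maps g k 0 -` ?U) \<subseteq> V"
  proof
    fix x assume x: "x \<in> ?U \<inter> (\<Inter>k. iterate_maps g k 0 -` ?U)"
    \<comment> \<open>Time 0 comes from the factor \<open>?U\<close>, time \<open>Suc j\<close> from
      \<open>iterate_maps g j 0\<close>.\<close>
    have orbU: "orbit g k x \<in> ?U" for k
    proof (cases k)
      case (Suc j)
      have "iterate_maps g j 0 x \<in> ?U" using x by blast
      then show ?thesis unfolding Suc iterate_maps_eq_orbit .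
    qed (use x in simp)
    \<comment> \<open>Scales of at most 1 do not increase norms, so the rescaled orbit stays in the
      ball as well.\<close>
    have "norm (orbit (hyperbolic_system.g a \<eta>') k x) < R" for k
      unfolding orb using T_down[of k "orbit g k x"] orbU[of k] norm_le_coord_proj[of "orbit g k x" S]
      by simp
    then show "x \<in> V" using x by (intro orbit_in_ball_imp_V) auto
  qed
  have "0 \<in> ?U" using VU zero_in_V by blast
  show ?thesis
    unfolding H_stable
  proof (rule exI[of _ ?U], rule exI[of _ V], intro conjI allI impI)
    fix x assume "x 0 \<in> V \<and> (\<forall>k. x (Suc k) = g k (x k))"
    then show "(\<lambda>k. g k (x k)) \<longlonglongrightarrow> 0" by (intro conv) auto
  qed (fact U \<open>0 \<in> ?U\<close> VU zero_in_V V_submanifold V_tangent_space stay)+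
qed

end
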